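(* Let $u,v$ be regular enough functions on $[a,b]\times[0,\infty)$, periodic in $x$, expanded as $$u(x,t)=\hat u_0+\boldsymbol{\omega}(x)^\top \boldsymbol{q}(t),\qquad v(x,t)=\hat v_0+\boldsymbol{\omega}(x)^\top\boldsymbol{p}(t).$$ Then, in terms of the coefficient vectors $\boldsymbol q,\boldsymbol p$, the system $$u_t=v_x,\qquad v_t=-u_{xxx}+(u^2)_x$$ can be cast in Hamiltonian form: $(u,v)$ satisfies this system if and only if $$\frac{d}{dt}\begin{pmatrix}\boldsymbol q\\ \boldsymbol p\end{pmatrix}=\begin{pmatrix}(D\otimes J_2^\top)\boldsymbol p\\ (D\otimes J_2^\top)\left[(D^2\otimes I_2)\boldsymbol q+\int_a^b\boldsymbol\omega(x)\left(\hat u_0+\boldsymbol\omega(x)^\top\boldsymbol q\right)^2dx\right]\end{pmatrix},$$ and the right-hand side equals $\left(|J_2|\otimes D\otimes J_2^\top\right)\nabla H(\boldsymbol q,\boldsymbol p)$ with Hamiltonian $$H(\boldsymbol q,\boldsymbol p)=\frac12\left[\boldsymbol p^\top\boldsymbol p+\boldsymbol q^\top(D^2\otimes I_2)\boldsymbol q+\frac23\int_a^b\left(\hat u_0+\boldsymbol\omega(x)^\top\boldsymbol q\right)^3dx\right].$$ Moreover, via the expansions $u=\hat u_0+\boldsymbol\omega(x)^\top\boldsymbol q$ and $v=\hat v_0+\boldsymbol\omega(x)^\top\boldsymbol p$, $H(\boldsymbol q,\boldsymbol p)$ is equal, up to an additive constant (independent of $\boldsymbol q,\boldsymbol p$), to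 the functional $$\mathcal H[u,v]=\frac12\int_a^b\left(v^2+\frac23u^3+u_x^2\right)dx .$$
   Context: Here $a<b$ are real numbers. For $j\ge1$ let $$c_j(x)=\sqrt{\frac{2}{b-a}}\cos\left(2\pi j\frac{x-a}{b-a}\right),\qquad s_j(x)=\sqrt{\frac{2}{b-a}}\sin\left(2\pi j\frac{x-a}{b-a}\right),$$ which together with the constant function $c_0(x)=1/\sqrt{b-a}$ form an orthonormal basis of $L^2[a,b]$. Define the infinite vectors $$\boldsymbol\omega(x)=(s_1(x),c_1(x),s_2(x),c_2(x),\dots)^\top,\quad \boldsymbol q(t)=(\beta_1(t),\alpha_1(t),\beta_2(t),\alpha_2(t),\dots)^\top,\quad \boldsymbol p(t)=(\eta_1(t),\xi_1(t),\eta_2(t),\xi_2(t),\dots)^\top,$$ so that $\boldsymbol\omega^\top\boldsymbol q=\sum_{j\ge1}(\alpha_jc_j+\beta_js_j)$ and $\boldsymbol\omega^\top\boldsymbol p=\sum_{j\ge1}(\xi_jc_j+\eta_js_j)$. The numbers $\hat u_0=\frac1{b-a}\int_a^bu(x,0)\,dx$ and $\hat v_0=\frac1{b-a}\int_a^bv(x,0)\,dx$ are the (time-independent) spatial means of $u$ and $v$. $I_2$ is the $2\times2$ identity, $$J_2=\begin{pmatrix}0&1\\-1&0\end{pmatrix},\qquad |J_2|=\begin{pmatrix}0&1\\1&0\end{pmatrix},\qquad D=\frac{2\pi}{b-a}\,\mathrm{diag}(1,2,3,\dots)$$ ($D$ is an infinite diagonal matrix), and $\otimes$ is the Kronecker product.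 $\nabla H$ is the vector of partial derivatives of $H$ with respect to the entries of $\boldsymbol q$ and then of $\boldsymbol p$; identities between infinite vectors are entrywise. Standing assumption: $u$ and $v$ are regular enough as periodic functions on $[a,b]$ for all $t\ge0$; in particular their $(b-a)$-periodic extensions in $x$ are of class $C^3$ for each $t$, and $u$, $v$, their $x$-derivatives up to order 3, $u_t$ and $v_t$ are continuous on $[a,b]\times[0,\infty)$. *)

theory Defs
  imports "HOL-Analysis.Analysis"
begin

section \<open>Infinite vectors and matrices\<close>

text \<open>
  Vectors and matrices are functions on arbitrary index types. A Kronecker product is indexed by
  pairs; read lexicographically, this is the usual block ordering. Mode index \<open>n :: nat\<close> stands
  for the frequency \<open>j = n + 1\<close>. Within a mode, and likewise for the two halves of a stacked
  vector, the index type is \<open>2\<close>, with elements \<open>1\<close> (first) and \<open>2\<close> (second).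
\<close>

type_synonym modes = "nat \<times> 2 \<Rightarrow> real"

definition entries :: "real ^ 'j ^ 'i \<Rightarrow> 'i \<Rightarrow> 'j \<Rightarrow> real" where
  "entries M i j = M $ i $ j"

definition dot :: "('i \<Rightarrow> real) \<Rightarrow> ('i \<Rightarrow> real) \<Rightarrow> real" where
  "dot x y = (\<Sum>\<^sub>\<infinity>i. x i * y i)"

definition mat_vec :: "('i \<Rightarrow> 'j \<Rightarrow> real) \<Rightarrow> ('j \<Rightarrow> real) \<Rightarrow> 'i \<Rightarrow> real"  (infixr \<open>\<cdot>\<^sub>v\<close> 70) where
  "(A \<cdot>\<^sub>v x) i = (\<Sum>\<^sub>\<infinity>j. A i j * x j)"

definition mat_mat :: "('i \<Rightarrow> 'j \<Rightarrow> real) \<Rightarrow> ('j \<Rightarrow> 'k \<Rightarrow> real) \<Rightarrow> 'i \<Rightarrow> 'k \<Rightarrow> real"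
    (infixl \<open>\<cdot>\<^sub>m\<close> 75) where
  "(A \<cdot>\<^sub>m B) i k = (\<Sum>\<^sub>\<infinity>j. A i j * B j k)"

definition kron :: "('i \<Rightarrow> 'j \<Rightarrow> real) \<Rightarrow> ('k \<Rightarrow> 'l \<Rightarrow> real) \<Rightarrow> 'i \<times> 'k \<Rightarrow> 'j \<times> 'l \<Rightarrow> real"
    (infixr \<open>\<otimes>\<^sub>K\<close> 72) where
  "(A \<otimes>\<^sub>K B) r c = A (fst r) (fst c) * B (snd r) (snd c)"

definition stack :: "('k \<Rightarrow> real) \<Rightarrow> ('k \<Rightarrow> real) \<Rightarrow> 2 \<times> 'k \<Rightarrow> real" where
  "stack x y i = (if fst i = 1 then x (snd i) else y (snd i))"

definition J2 :: "real ^ 2 ^ 2" where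
  "J2 = vector [vector [0, 1], vector [-1, 0]]"

definition abs_J2 :: "real ^ 2 ^ 2" where
  "abs_J2 = vector [vector [0, 1], vector [1, 0]]"

definition I2 :: "real ^ 2 ^ 2" where
  "I2 = mat 1"

definition Dmat :: "real \<Rightarrow> real \<Rightarrow> nat \<Rightarrow> nat \<Rightarrow> real" where
  "Dmat a b m n = (if m = n then 2 * pi / (b - a) * real (n + 1) else 0)"


section \<open>The trigonometric basis\<close>

definition cos_mode :: "real \<Rightarrow> real \<Rightarrow> nat \<Rightarrow> real \<Rightarrow> real" where
  "cos_mode a b j x = sqrt (2 / (b - a)) * cos (2 * pi * real j * ((x - a) / (b - a)))"

definition sin_mode :: "real \<Rightarrow> real \<Rightarrow> nat \<Rightarrow> real \<Rightarrow> real" where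
  "sin_mode a b j x = sqrt (2 / (b - a)) * sin (2 * pi * real j * ((x - a) / (b - a)))"

definition \<omega> :: "real \<Rightarrow> real \<Rightarrow> real \<Rightarrow> modes" where
  "\<omega> a b x = (\<lambda>(n, r). if r = 1 then sin_mode a b (n + 1) x else cos_mode a b (n + 1) x)"


section \<open>Regularity and expansion\<close>

text \<open>
  Functions on \<open>[a, b] \<times> [0, \<infinity>)\<close> that are periodic in \<open>x\<close> are identified with their
  periodic extensions in \<open>x\<close>; values at \<open>t < 0\<close> are irrelevant. Time derivatives
  are relative to \<open>[0, \<infinity>)\<close>, hence one-sided at \<open>t = 0\<close>.
\<close>

definition dx :: "nat \<Rightarrow> (real \<Rightarrow> real \<Rightarrow> real) \<Rightarrow> real \<Rightarrow> real \<Rightarrow> real" where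
  "dx k f x t = (deriv ^^ k) (\<lambda>y. f y t) x"

definition dt :: "(real \<Rightarrow> real \<Rightarrow> real) \<Rightarrow> real \<Rightarrow> real \<Rightarrow> real" where
  "dt f x t = vector_derivative (f x) (at t within {0..})"

definition periodic_regular :: "real \<Rightarrow> real \<Rightarrow> (real \<Rightarrow> real \<Rightarrow> real) \<Rightarrow> bool" where
  "periodic_regular a b f \<longleftrightarrow>
     (\<forall>t\<ge>0. \<forall>x. f (x + (b - a)) t = f x t) \<and>
     (\<forall>t\<ge>0. \<forall>k<3. \<forall>x. (\<lambda>y. dx k f y t) differentiable (at x)) \<and>
     (\<forall>t\<ge>0. continuous_on UNIV (\<lambda>x. dx 3 f x t)) \<and>
     (\<forall>k\<le>3. continuous_on ({a..b} \<times> {0..}) (\<lambda>(x, t). dx k f x t)) \<and>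
     (\<forall>x\<in>{a..b}. \<forall>t\<ge>0. f x differentiable (at t within {0..})) \<and>
     continuous_on ({a..b} \<times> {0..}) (\<lambda>(x, t). dt f x t)"

text \<open>
  Summability has to be stated separately, since a non-summable \<^const>\<open>dot\<close> is \<open>0\<close> by
  convention. Evaluating the expansion with the fixed constant \<open>f0\<close> at all times forces the spatial
  mean of \<open>f\<close> to be independent of time.
\<close>

definition expanded ::
  "real \<Rightarrow> real \<Rightarrow> real \<Rightarrow> (real \<Rightarrow> real \<Rightarrow> real) \<Rightarrow> (real \<Rightarrow> modes) \<Rightarrow> bool" where
  "expanded a b f0 f w \<longleftrightarrow>
     f0 = 1 / (b - a) * integral {a..b} (\<lambda>x. f x 0) \<and>
     (\<forall>x\<in>{a..b}. \<forall>t\<ge>0. (\<lambda>k. \<omega> a b x k * w t k) summable_on UNIV \<and>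
        f x t = f0 + dot (\<omega> a b x) (w t))"


section \<open>The Hamiltonian system\<close>

definition pde_system ::
  "real \<Rightarrow> real \<Rightarrow> (real \<Rightarrow> real \<Rightarrow> real) \<Rightarrow> (real \<Rightarrow> real \<Rightarrow> real) \<Rightarrow> bool" where
  "pde_system a b u v \<longleftrightarrow>
     (\<forall>x\<in>{a..b}. \<forall>t\<ge>0. dt u x t = dx 1 v x t \<and>
        dt v x t = - dx 3 u x t + dx 1 (\<lambda>y s. (u y s)\<^sup>2) x t)"

definition ode_rhs :: "real \<Rightarrow> real \<Rightarrow> real \<Rightarrow> modes \<Rightarrow> modes \<Rightarrow> 2 \<times> nat \<times> 2 \<Rightarrow> real" where
  "ode_rhs a b u0 q p =
     stack ((Dmat a b \<otimes>\<^sub>K entries (transpose J2)) \<cdot>\<^sub>v p)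
       ((Dmat a b \<otimes>\<^sub>K entries (transpose J2)) \<cdot>\<^sub>v
          (\<lambda>k. (((Dmat a b \<cdot>\<^sub>m Dmat a b) \<otimes>\<^sub>K entries I2) \<cdot>\<^sub>v q) k
             + integral {a..b} (\<lambda>x. \<omega> a b x k * (u0 + dot (\<omega> a b x) q)\<^sup>2)))"

definition ode_system ::
  "real \<Rightarrow> real \<Rightarrow> real \<Rightarrow> (real \<Rightarrow> modes) \<Rightarrow> (real \<Rightarrow> modes) \<Rightarrow> bool" where
  "ode_system a b u0 q p \<longleftrightarrow>
     (\<forall>t\<ge>0. \<forall>i. ((\<lambda>s. stack (q s) (p s) i) has_real_derivative ode_rhs a b u0 (q t) (p t) i)
        (at t within {0..}))"

definition hamiltonian :: "real \<Rightarrow> real \<Rightarrow> real \<Rightarrow> modes \<Rightarrow> modes \<Rightarrow> real" where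
  "hamiltonian a b u0 q p =
     1 / 2 * (dot p p + dot q (((Dmat a b \<cdot>\<^sub>m Dmat a b) \<otimes>\<^sub>K entries I2) \<cdot>\<^sub>v q)
       + 2 / 3 * integral {a..b} (\<lambda>x. (u0 + dot (\<omega> a b x) q) ^ 3))"

definition has_partials :: "(('k \<Rightarrow> real) \<Rightarrow> ('k \<Rightarrow> real) \<Rightarrow> real) \<Rightarrow> ('k \<Rightarrow> real) \<Rightarrow> ('k \<Rightarrow> real) \<Rightarrow> bool"
  where
  "has_partials H q p \<longleftrightarrow>
     (\<forall>k. (\<lambda>h. H (q(k := h)) p) differentiable (at (q k)) \<and>
          (\<lambda>h. H q (p(k := h))) differentiable (at (p k)))"

definition grad ::
  "(('k \<Rightarrow> real) \<Rightarrow> ('k \<Rightarrow> real) \<Rightarrow> real) \<Rightarrow> ('k \<Rightarrow> real) \<Rightarrow> ('k \<Rightarrow> real) \<Rightarrow> 2 \<times> 'k \<Rightarrow> real" where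
  "grad H q p =
     stack (\<lambda>k. deriv (\<lambda>h. H (q(k := h)) p) (q k)) (\<lambda>k. deriv (\<lambda>h. H q (p(k := h))) (p k))"

definition energy :: "real \<Rightarrow> real \<Rightarrow> (real \<Rightarrow> real) \<Rightarrow> (real \<Rightarrow> real) \<Rightarrow> real" where
  "energy a b f g =
     1 / 2 * integral {a..b} (\<lambda>x. (g x)\<^sup>2 + 2 / 3 * (f x) ^ 3 + (deriv f x)\<^sup>2)"

end

theory Submission
  imports Defs
begin

text \<open>
  The system and the differential equations for the coefficients are the same statement read in
  two coordinate systems for functions of \<open>x\<close>: point values, and inner products with the
  trigonometric basis.

  Only pointwise summability of the expansions is assumed, so it has to be shown that \<open>q(t)\<close> and
  \<open>p(t)\<close> are the Fourier coefficients of \<open>u(\<cdot>, t)\<close> and \<open>v(\<cdot>, t)\<close> at all. By the Denjoy-Luzin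
  theorem (\<open>Denjoy_Luzin\<close>) a trigonometric series that converges absolutely at every point has
  absolutely summable coefficients. Hence it converges uniformly and may be integrated term by term
  against any continuous function (\<open>expansion_termwise_integral\<close>). This single formula yields the
  coefficients, the constancy of the mean and the identities of Parseval type.

  Integration by parts turns \<open>d/dx\<close> into multiplication by \<open>D \<otimes> J\<^sub>2\<^sup>T\<close>
  (\<open>fourier_coeff_derivative\<close>), whose square is \<open>-(D\<^sup>2 \<otimes> I\<^sub>2)\<close>. Differentiation under the
  integral sign turns \<open>d/dt\<close> of the coefficients into the coefficients of the time derivative
  (\<open>coefficient_ode_iff\<close>). So the differential equation for the coefficients says exactly that all
  nonconstant Fourier coefficients of the two residuals of the system vanish. The residuals have mean
  zero: their time derivatives because the means of \<open>u\<close> and \<open>v\<close> are constant, the other terms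
  because they are \<open>x\<close>-derivatives of periodic functions. Completeness of the trigonometric system
  among continuous periodic functions (\<open>trig_system_complete\<close>) then makes the residuals vanish
  pointwise (\<open>pde_iff_ode_at\<close>).

  As a function of one entry of \<open>q\<close> the Hamiltonian is a cubic polynomial, and of one entry of \<open>p\<close>
  a quadratic one, so its gradient can be read off (\<open>hamiltonian_gradient\<close>). The factor \<open>|J\<^sub>2|\<close>
  only interchanges the two halves of that gradient.

  Termwise integration also gives \<open>p\<^sup>T p = \<integral> v\<^sup>2 - v\<^sub>0\<^sup>2 (b - a)\<close> and
  \<open>q\<^sup>T (D\<^sup>2 \<otimes> I\<^sub>2) q = \<integral> u\<^sub>x\<^sup>2\<close>. Hence Hamiltonian and energy differ by the constant
  \<open>- v\<^sub>0\<^sup>2 (b - a) / 2\<close>, the contribution of the mean of \<open>v\<close>, which \<open>p\<close> does not see.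
\<close>


section \<open>The structure matrices\<close>

lemma infsum_finite_support:
  fixes f :: "'i \<Rightarrow> real"
  assumes "finite F" "\<And>i. i \<notin> F \<Longrightarrow> f i = 0"
  shows "infsum f UNIV = sum f F"
  using assms infsum_cong_neutral[of F UNIV f f] by simp

definition freq :: "real \<Rightarrow> real \<Rightarrow> nat \<Rightarrow> real" where
  "freq a b n = 2 * pi / (b - a) * real (n + 1)"

text \<open>
  In trigonometric coefficients this matrix is \<open>d/dx\<close>: it sends the coefficients of a periodic function
  to those of its derivative. Consequently the next matrix is \<open>-d\<^sup>2/dx\<^sup>2\<close>.
\<close>

abbreviation deriv_matrix :: "real \<Rightarrow> real \<Rightarrow> nat \<times> 2 \<Rightarrow> nat \<times> 2 \<Rightarrow> real" where
  "deriv_matrix a b \<equiv> Dmat a b \<otimes>\<^sub>K entries (transpose J2)"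

abbreviation neg_laplacian_matrix :: "real \<Rightarrow> real \<Rightarrow> nat \<times> 2 \<Rightarrow> nat \<times> 2 \<Rightarrow> real" where
  "neg_laplacian_matrix a b \<equiv> (Dmat a b \<cdot>\<^sub>m Dmat a b) \<otimes>\<^sub>K entries I2"

lemma deriv_matrix_apply:
  "(deriv_matrix a b \<cdot>\<^sub>v x) (n, r) =
     (if r = 1 then - freq a b n * x (n, 2) else freq a b n * x (n, 1))"
proof -
  have "(deriv_matrix a b \<cdot>\<^sub>v x) (n, r) =
      (\<Sum>j\<in>{(n, 1), (n, 2)}. deriv_matrix a b (n, r) j * x j)"
    unfolding mat_vec_def
  proof (rule infsum_finite_support)
    fix i :: "nat \<times> 2"
    assume "i \<notin> {(n, 1), (n, 2)}"
    then have "fst i \<noteq> n" using exhaust_2 by (cases i) auto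
    then show "deriv_matrix a b (n, r) i * x i = 0"
      by (simp add: kron_def Dmat_def)
  qed simp
  then show ?thesis
    using exhaust_2[of r]
    by (auto simp: kron_def Dmat_def entries_def transpose_def J2_def freq_def)
qed

lemma neg_laplacian_matrix_apply:
  "(neg_laplacian_matrix a b \<cdot>\<^sub>v x) (n, r) = (freq a b n)\<^sup>2 * x (n, r)"
proof -
  have DD: "(Dmat a b \<cdot>\<^sub>m Dmat a b) m l = (if m = l then (freq a b m)\<^sup>2 else 0)" for m l
  proof -
    have "(Dmat a b \<cdot>\<^sub>m Dmat a b) m l = (\<Sum>j\<in>{m}. Dmat a b m j * Dmat a b j l)"
      unfolding mat_mat_def by (rule infsum_finite_support) (auto simp: Dmat_def)
    then show ?thesis by (auto simp: Dmat_def freq_def power2_eq_square)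
  qed
  have "(neg_laplacian_matrix a b \<cdot>\<^sub>v x) (n, r) =
      (\<Sum>j\<in>{(n, r)}. neg_laplacian_matrix a b (n, r) j * x j)"
    unfolding mat_vec_def
    by (rule infsum_finite_support) (auto simp: kron_def DD entries_def I2_def mat_def)
  then show ?thesis by (simp add: kron_def DD entries_def I2_def mat_def)
qed

lemma deriv_matrix_twice:
  "deriv_matrix a b \<cdot>\<^sub>v deriv_matrix a b \<cdot>\<^sub>v x = (\<lambda>k. - (neg_laplacian_matrix a b \<cdot>\<^sub>v x) k)"
proof
  fix k :: "nat \<times> 2"
  obtain n r where "k = (n, r)" by (cases k)
  then show "(deriv_matrix a b \<cdot>\<^sub>v deriv_matrix a b \<cdot>\<^sub>v x) k = - (neg_laplacian_matrix a b \<cdot>\<^sub>v x) k"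
    using exhaust_2[of r]
    by (auto simp: deriv_matrix_apply neg_laplacian_matrix_apply power2_eq_square)
qed

text \<open>
  The factor \<open>|J\<^sub>2|\<close> exchanges the two halves of a stacked vector, so that the evolution of either
  unknown is driven by the gradient with respect to the other one.
\<close>

lemma structure_matrix_apply:
  "(entries abs_J2 \<otimes>\<^sub>K Dmat a b \<otimes>\<^sub>K entries (transpose J2)) \<cdot>\<^sub>v stack x y =
     stack (deriv_matrix a b \<cdot>\<^sub>v y) (deriv_matrix a b \<cdot>\<^sub>v x)"
proof
  fix i :: "2 \<times> nat \<times> 2"
  obtain s n r where i: "i = (s, n, r)" by (cases i)
  let ?M = "entries abs_J2 \<otimes>\<^sub>K Dmat a b \<otimes>\<^sub>K entries (transpose J2)"
  let ?F = "{(1, n, 1), (1, n, 2), (2, n, 1), (2, n, 2)} :: (2 \<times> nat \<times> 2) set"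
  have "(?M \<cdot>\<^sub>v stack x y) i = (\<Sum>j\<in>?F. ?M i j * stack x y j)"
    unfolding mat_vec_def
  proof (rule infsum_finite_support)
    fix j :: "2 \<times> nat \<times> 2"
    assume "j \<notin> ?F"
    moreover have "fst j = 1 \<or> fst j = 2" "snd (snd j) = 1 \<or> snd (snd j) = 2"
      using exhaust_2 by blast+
    ultimately have "fst (snd j) \<noteq> n" by (cases j) auto
    then show "?M i j * stack x y j = 0" by (simp add: kron_def Dmat_def i)
  qed simp
  also have "\<dots> = stack (deriv_matrix a b \<cdot>\<^sub>v y) (deriv_matrix a b \<cdot>\<^sub>v x) i"
    using exhaust_2[of r] exhaust_2[of s]
    by (auto simp: i stack_def deriv_matrix_apply)
       (auto simp: kron_def Dmat_def entries_def transpose_def J2_def abs_J2_def freq_def)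
  finally show "(?M \<cdot>\<^sub>v stack x y) i =
    stack (deriv_matrix a b \<cdot>\<^sub>v y) (deriv_matrix a b \<cdot>\<^sub>v x) i" .
qed

section \<open>Orthonormality of the trigonometric system\<close>

text \<open>
  The angle in \<open>[0, 2\<pi>]\<close> that corresponds to a point of \<open>[a, b]\<close>. It reduces the basis functions to
  \<open>sin (j \<theta>)\<close> and \<open>cos (j \<theta>)\<close>, and trigonometric polynomials to polynomials on the unit circle.
\<close>

definition phase :: "real \<Rightarrow> real \<Rightarrow> real \<Rightarrow> real" where
  "phase a b x = 2 * pi / (b - a) * (x - a)"

lemma \<omega>_phase:
  "\<omega> a b x (n, r) = sqrt (2 / (b - a)) *
     (if r = 1 then sin (real (n + 1) * phase a b x) else cos (real (n + 1) * phase a b x))"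
proof -
  have "2 * pi * real (n + 1) * ((x - a) / (b - a)) = real (n + 1) * phase a b x"
    unfolding phase_def divide_inverse by (simp only: mult_ac)
  then show ?thesis by (simp only: \<omega>_def sin_mode_def cos_mode_def prod.case split: if_split) simp
qed

lemma phase_derivative [derivative_intros]:
  assumes "(f has_real_derivative f') (at x within S)"
  shows "((\<lambda>x. phase a b (f x)) has_real_derivative 2 * pi / (b - a) * f') (at x within S)"
  unfolding phase_def
  by (rule derivative_eq_intros assms refl | simp)+

lemma phase_cont [continuous_intros]:
  fixes f :: "'a::t2_space \<Rightarrow> real"
  assumes "continuous_on S f"
  shows "continuous_on S (\<lambda>x. phase a b (f x))"
  unfolding phase_def by (intro continuous_intros assms)

lemma \<omega>_cont [continuous_intros]:
  fixes f :: "'a::t2_space \<Rightarrow> real"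
  assumes "continuous_on S f"
  shows "continuous_on S (\<lambda>x. \<omega> a b (f x) k)"
proof (cases k)
  case (Pair n r)
  then show ?thesis
    by (cases "r = 1") (simp_all only: \<omega>_phase if_False simp_thms if_True,
        (intro continuous_intros assms)+)
qed

lemma \<omega>_derivative:
  "((\<lambda>x. \<omega> a b x (n, r)) has_real_derivative
     (if r = 1 then freq a b n * \<omega> a b x (n, 2) else - freq a b n * \<omega> a b x (n, 1))) (at x within S)"
  by (auto simp: \<omega>_phase freq_def simp del: of_nat_add intro!: derivative_eq_intros)

context
  fixes a b :: real
  assumes ab: "a < b"
begin

lemma phase_ends: "phase a b a = 0" "phase a b b = 2 * pi"
  using ab by (auto simp: phase_def)

lemma \<omega>_ends: "\<omega> a b b k = \<omega> a b a k"
proof (cases k)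
  case (Pair n r)
  have "sin (real (n + 1) * (2 * pi)) = 0" "cos (real (n + 1) * (2 * pi)) = 1"
    using sin_int_2pin[of "int n + 1"] cos_int_2pin[of "int n + 1"] by (simp_all add: mult_ac add_ac)
  then show ?thesis by (simp only: Pair \<omega>_phase phase_ends mult_zero_right sin_zero cos_zero)
qed

lemma \<omega>_bound: "\<bar>\<omega> a b x k\<bar> \<le> sqrt (2 / (b - a))"
  using ab by (cases k) (auto simp: \<omega>_phase abs_mult divide_simps intro!: mult_left_le)

lemma has_integral_cos_phase:
  "((\<lambda>x. cos (of_int m * phase a b x)) has_integral (if m = 0 then b - a else 0)) {a..b}"
proof (cases "m = 0")
  case True
  then show ?thesis using has_integral_const_real[of "1::real" a b] ab by simp
next
  case False
  let ?F = "\<lambda>x. (b - a) / (2 * pi * of_int m) * sin (of_int m * phase a b x)"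
  have "((\<lambda>x. cos (of_int m * phase a b x)) has_integral ?F b - ?F a) {a..b}"
    using ab False
    by (intro fundamental_theorem_of_calculus)
       (auto simp flip: has_real_derivative_iff_has_vector_derivative intro!: derivative_eq_intros)
  moreover have "sin (of_int m * phase a b b) = 0" "sin (of_int m * phase a b a) = 0"
    using sin_int_2pin[of m] by (simp_all add: phase_ends mult_ac)
  ultimately show ?thesis using False by simp
qed

lemma has_integral_sin_phase:
  "((\<lambda>x. sin (of_int m * phase a b x)) has_integral 0) {a..b}"
proof (cases "m = 0")
  case False
  let ?F = "\<lambda>x. - ((b - a) / (2 * pi * of_int m)) * cos (of_int m * phase a b x)"
  have "((\<lambda>x. sin (of_int m * phase a b x)) has_integral ?F b - ?F a) {a..b}"
    using ab False
    by (intro fundamental_theorem_of_calculus)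
       (auto simp flip: has_real_derivative_iff_has_vector_derivative intro!: derivative_eq_intros)
  moreover have "cos (of_int m * phase a b b) = 1" "cos (of_int m * phase a b a) = 1"
    using cos_int_2pin[of m] by (simp_all add: phase_ends mult_ac)
  ultimately show ?thesis by simp
qed simp

lemma integral_\<omega>: "integral {a..b} (\<lambda>x. \<omega> a b x k) = 0"
proof (cases k)
  case (Pair n r)
  show ?thesis
    using integral_unique[OF has_integral_sin_phase[of "int n + 1"]]
      integral_unique[OF has_integral_cos_phase[of "int n + 1"]]
    by (cases "r = 1") (auto simp: Pair \<omega>_phase add.commute)
qed

text \<open>
  Products of basis functions become sums by the addition theorems. Of the resulting terms
  only \<open>cos ((m - n) \<theta>)\<close> with \<open>m = n\<close> has a nonzero integral over a period.
\<close>

lemma \<omega>_orthonormal: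
  "integral {a..b} (\<lambda>x. \<omega> a b x k * \<omega> a b x l) = (if k = l then 1 else 0)"
proof -
  obtain m r n s where kl: "k = (m, r)" "l = (n, s)" by (cases k, cases l)
  define C D S T where "C x = cos (of_int (int m - int n) * phase a b x)"
    and "D x = cos (of_int (int m + int n + 2) * phase a b x)"
    and "S x = sin (of_int (int m - int n) * phase a b x)"
    and "T x = sin (of_int (int m + int n + 2) * phase a b x)" for x
  have C: "(C has_integral (if m = n then b - a else 0)) {a..b}"
    using has_integral_cos_phase[of "int m - int n"] by (simp add: C_def[abs_def])
  have D: "(D has_integral 0) {a..b}"
    using has_integral_cos_phase[of "int m + int n + 2"] by (simp add: D_def[abs_def] split: if_splits)
  have S: "(S has_integral 0) {a..b}" and T: "(T has_integral 0) {a..b}"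
    unfolding S_def[abs_def] T_def[abs_def] by (rule has_integral_sin_phase)+
  have eq: "\<omega> a b x k * \<omega> a b x l = 1 / (b - a) *
      (if r = 1 then (if s = 1 then C x - D x else T x + S x)
       else (if s = 1 then T x - S x else C x + D x))" for x
  proof -
    let ?p = "phase a b x"
    have CS: "real (m + 1) * ?p - real (n + 1) * ?p = of_int (int m - int n) * ?p"
      "real (m + 1) * ?p + real (n + 1) * ?p = of_int (int m + int n + 2) * ?p"
      by (auto simp: algebra_simps)
    have "sqrt (2 / (b - a)) * y * (sqrt (2 / (b - a)) * z) = 2 / (b - a) * (y * z)" for y z
      using ab by (simp add: algebra_simps flip: mult.assoc)
    then show ?thesis
      using exhaust_2[of r] exhaust_2[of s] CS[symmetric]
      by (auto simp: kl \<omega>_phase C_def D_def S_def T_def sin_times_sin sin_times_cos cos_times_sin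
          cos_times_cos simp del: of_nat_add of_int_diff of_int_add)
  qed
  have "((\<lambda>x. \<omega> a b x k * \<omega> a b x l) has_integral
     1 / (b - a) * (if r = 1 then (if s = 1 then (if m = n then b - a else 0) - 0 else 0 + 0)
       else (if s = 1 then 0 - 0 else (if m = n then b - a else 0) + 0))) {a..b}"
    unfolding eq
    using has_integral_diff[OF C D] has_integral_add[OF T S] has_integral_diff[OF T S]
      has_integral_add[OF C D]
    by (intro has_integral_mult_right) (simp split: if_splits)
  then show ?thesis
    using ab exhaust_2[of r] exhaust_2[of s] by (auto simp: kl dest!: integral_unique)
qed

end

section \<open>Completeness of the trigonometric system\<close>

text \<open>
  Frequencies of both signs are admitted, so that a shift of the frequency by \<open>\<plusminus>1\<close> never leaves the
  family. Stating the conditions as integrals with value \<open>0\<close>, rather than as values of integrals, makes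
  them stable under linear combinations without side conditions of integrability.
\<close>

definition trig_null :: "real \<Rightarrow> real \<Rightarrow> (real \<Rightarrow> real) \<Rightarrow> bool" where
  "trig_null a b h \<longleftrightarrow> (\<forall>m::int.
     ((\<lambda>x. h x * cos (of_int m * phase a b x)) has_integral 0) {a..b} \<and>
     ((\<lambda>x. h x * sin (of_int m * phase a b x)) has_integral 0) {a..b})"

lemma trig_null_linear:
  assumes "trig_null a b h" "trig_null a b g"
  shows "trig_null a b (\<lambda>x. c * h x + d * g x)"
  unfolding trig_null_def
proof (intro allI conjI)
  fix m :: int
  show "((\<lambda>x. (c * h x + d * g x) * cos (of_int m * phase a b x)) has_integral 0) {a..b}"
    using has_integral_add[OF has_integral_mult_right[of "\<lambda>x. h x * cos (of_int m * phase a b x)" 0 _ c]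
        has_integral_mult_right[of "\<lambda>x. g x * cos (of_int m * phase a b x)" 0 _ d]]
      assms by (simp add: trig_null_def algebra_simps)
  show "((\<lambda>x. (c * h x + d * g x) * sin (of_int m * phase a b x)) has_integral 0) {a..b}"
    using has_integral_add[OF has_integral_mult_right[of "\<lambda>x. h x * sin (of_int m * phase a b x)" 0 _ c]
        has_integral_mult_right[of "\<lambda>x. g x * sin (of_int m * phase a b x)" 0 _ d]]
      assms by (simp add: trig_null_def algebra_simps)
qed

text \<open>
  Multiplication by \<open>cos \<theta>\<close> or \<open>sin \<theta>\<close> replaces a frequency \<open>m\<close> by the frequencies \<open>m \<plusminus> 1\<close>.
\<close>

lemma trig_null_times_trig:
  assumes "trig_null a b h"
  shows "trig_null a b (\<lambda>x. h x * cos (phase a b x))" "trig_null a b (\<lambda>x. h x * sin (phase a b x))"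
proof -
  let ?c = "\<lambda>m x. h x * cos (of_int m * phase a b x)"
  let ?s = "\<lambda>m x. h x * sin (of_int m * phase a b x)"
  have c: "(?c m has_integral 0) {a..b}" and s: "(?s m has_integral 0) {a..b}" for m :: int
    using assms by (simp_all add: trig_null_def)
  have arg: "of_int m * phase a b x + phase a b x = of_int (m + 1) * phase a b x"
    "of_int m * phase a b x - phase a b x = of_int (m - 1) * phase a b x" for m :: int and x
    by (simp_all add: algebra_simps)
  have half: "((\<lambda>x. (f x + g x) / 2) has_integral 0) {a..b}" "((\<lambda>x. (f x - g x) / 2) has_integral 0) {a..b}"
    if "(f has_integral 0) {a..b}" "(g has_integral 0) {a..b}" for f g :: "real \<Rightarrow> real"
    using has_integral_divide[OF has_integral_add[OF that], of 2]
      has_integral_divide[OF has_integral_diff[OF that], of 2] by simp_all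
  have cc: "h x * cos (phase a b x) * cos (of_int m * phase a b x) = (?c (m - 1) x + ?c (m + 1) x) / 2"
    and cs: "h x * cos (phase a b x) * sin (of_int m * phase a b x) = (?s (m + 1) x + ?s (m - 1) x) / 2"
    and sc: "h x * sin (phase a b x) * cos (of_int m * phase a b x) = (?s (m + 1) x - ?s (m - 1) x) / 2"
    and ss: "h x * sin (phase a b x) * sin (of_int m * phase a b x) = (?c (m - 1) x - ?c (m + 1) x) / 2"
    for m :: int and x
    unfolding arg[symmetric] cos_add cos_diff sin_add sin_diff by (simp_all add: field_simps)
  show "trig_null a b (\<lambda>x. h x * cos (phase a b x))"
    unfolding trig_null_def cc cs by (intro allI conjI half c s)
  show "trig_null a b (\<lambda>x. h x * sin (phase a b x))"
    unfolding trig_null_def sc ss by (intro allI conjI half c s)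
qed

text \<open>
  Orthogonality to all trigonometric monomials is inherited under multiplication by any polynomial in
  \<open>cos \<theta>\<close> and \<open>sin \<theta>\<close>. In this form, with the function \<open>h\<close> arbitrary in the induction, a product of
  polynomials is treated by multiplying with its factors one after the other.
\<close>

lemma trig_null_times_polynomial:
  fixes P :: "complex \<Rightarrow> real"
  assumes "real_polynomial_function P" "trig_null a b h"
  shows "trig_null a b (\<lambda>x. h x * P (cis (phase a b x)))"
  using assms
proof (induction arbitrary: h)
  case (linear f)
  then interpret bounded_linear f by simp
  have "f (cis y) = cos y * f 1 + sin y * f \<i>" for y
  proof -
    have "cis y = cos y *\<^sub>R 1 + sin y *\<^sub>R \<i>" by (simp add: complex_eq_iff)
    then show ?thesis by (metis add scaleR real_scaleR_def)
  qed
  then show ?case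
    using trig_null_linear[OF trig_null_times_trig[OF linear.prems], of "f 1" "f \<i>"]
    by (simp add: algebra_simps)
next
  case (const c)
  then show ?case using trig_null_linear[OF const const, of c 0] by (simp add: mult.commute)
next
  case (add f g)
  then show ?case
    using trig_null_linear[OF add.IH(1)[OF add.prems] add.IH(2)[OF add.prems], of 1 1]
    by (simp add: algebra_simps)
next
  case (mult f g)
  then show ?case by (simp flip: mult.assoc)
qed

text \<open>
  A continuous function with equal values at the ends of \<open>[a, b]\<close> descends to the circle. Only continuity
  at the point \<open>1\<close>, where the argument jumps, is in question. The passage from loops to maps on the circle
  settles it, applied to the constant homotopy of a loop.
\<close>

lemma continuous_on_circle_of_periodic:
  fixes h :: "real \<Rightarrow> real"
  assumes h: "continuous_on {a..b} h" and "h a = h b" "a < b"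
  shows "continuous_on (sphere 0 1) (\<lambda>z. h (a + (b - a) * (Arg2pi z / (2 * pi))))"
proof -
  let ?p = "\<lambda>t. h (a + (b - a) * t)"
  have "(\<lambda>t. a + (b - a) * t) ` {0..1} \<subseteq> {a..b}"
  proof -
    have "a + (b - a) * t \<le> b" if "t \<le> 1" for t
      using mult_left_le[OF that, of "b - a"] assms(3) by linarith
    with assms(3) show ?thesis by (auto simp: image_subset_iff)
  qed
  then have "path ?p"
    unfolding path_def by (intro continuous_on_compose2[OF h] continuous_intros)
  moreover have "pathfinish ?p = pathstart ?p"
    using assms by (simp add: pathfinish_def pathstart_def)
  ultimately have "homotopic_loops UNIV ?p ?p"
    by (simp add: homotopic_loops_refl)
  from homotopic_with_imp_continuous[OF homotopic_loops_imp_homotopic_circlemaps[OF this]]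
  show ?thesis by (simp add: o_def)
qed

text \<open>
  By Stone-Weierstrass on the circle, \<open>h\<close> is within \<open>\<epsilon>\<close> of a polynomial \<open>P\<close> in \<open>cos \<theta>\<close>, \<open>sin \<theta>\<close>, and
  \<open>\<integral> h P = 0\<close>. Therefore \<open>\<integral> h\<^sup>2 = \<integral> h (h - P) \<le> \<epsilon> \<integral> |h|\<close> for every \<open>\<epsilon> > 0\<close>, so \<open>\<integral> h\<^sup>2 = 0\<close>.
\<close>

lemma trig_null_eq_0:
  assumes h: "continuous_on {a..b} h" and per: "h a = h b" and ab: "a < b"
    and null: "trig_null a b h" and x: "x \<in> {a..b}"
  shows "h x = 0"
proof -
  let ?G = "\<lambda>z. h (a + (b - a) * (Arg2pi z / (2 * pi)))"
  let ?e = "\<lambda>x. cis (phase a b x)"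
  have G: "?G (?e x) = h x" if x: "x \<in> {a..b}" for x
  proof (cases "x = b")
    case True
    then show ?thesis using ab per by (simp add: phase_ends Arg2pi_of_real[of 1, simplified])
  next
    case False
    have "Arg2pi (?e x) = phase a b x"
    proof (rule Arg2pi_unique[of 1])
      show "of_real 1 * exp (\<i> * of_real (phase a b x)) = ?e x" by (simp add: cis_conv_exp)
      have "(x - a) / (b - a) < 1" using x False ab by simp
      then have "2 * pi * ((x - a) / (b - a)) < 2 * pi * 1"
        by (intro mult_strict_left_mono) auto
      then show "phase a b x < 2 * pi" by (simp add: phase_def)
    qed (use x in \<open>auto simp: phase_def\<close>)
    then show ?thesis using ab by (simp add: phase_def)
  qed
  let ?K = "integral {a..b} (\<lambda>x. \<bar>h x\<bar>)"
  have le: "integral {a..b} (\<lambda>x. (h x)\<^sup>2) \<le> \<epsilon> * ?K" if "\<epsilon> > 0" for \<epsilon>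
  proof -
    obtain P where P: "real_polynomial_function P" "\<And>z. z \<in> sphere 0 1 \<Longrightarrow> \<bar>?G z - P z\<bar> < \<epsilon>"
      using Stone_Weierstrass_real_polynomial_function[OF compact_sphere
          continuous_on_circle_of_periodic[OF h per ab] \<open>\<epsilon> > 0\<close>] by blast
    have "((\<lambda>x. h x * P (?e x)) has_integral 0) {a..b}"
      using trig_null_times_polynomial[OF P(1) null]
      unfolding trig_null_def by (auto dest!: spec[of _ 0])
    moreover have "(\<lambda>x. (h x)\<^sup>2) integrable_on {a..b}"
      by (intro integrable_continuous_real continuous_intros h)
    ultimately have I: "((\<lambda>x. (h x)\<^sup>2 - h x * P (?e x)) has_integral
        integral {a..b} (\<lambda>x. (h x)\<^sup>2) - 0) {a..b}"
      by (intro has_integral_diff integrable_integral)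
    have "integral {a..b} (\<lambda>x. (h x)\<^sup>2) - 0 \<le> integral {a..b} (\<lambda>x. \<epsilon> * \<bar>h x\<bar>)"
    proof (rule has_integral_le[OF I])
      show "((\<lambda>x. \<epsilon> * \<bar>h x\<bar>) has_integral integral {a..b} (\<lambda>x. \<epsilon> * \<bar>h x\<bar>)) {a..b}"
        by (intro integrable_integral integrable_continuous_real continuous_intros h)
      fix x assume x: "x \<in> {a..b}"
      have "(h x)\<^sup>2 - h x * P (?e x) = h x * (?G (?e x) - P (?e x))"
        unfolding G[OF x] by (simp add: power2_eq_square algebra_simps)
      also have "\<dots> \<le> \<bar>h x\<bar> * \<bar>?G (?e x) - P (?e x)\<bar>"
        by (simp flip: abs_mult)
      also have "\<dots> \<le> \<bar>h x\<bar> * \<epsilon>"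
        using P(2)[of "?e x"] by (intro mult_left_mono) auto
      finally show "(h x)\<^sup>2 - h x * P (?e x) \<le> \<epsilon> * \<bar>h x\<bar>" by (simp add: mult.commute)
    qed
    then show ?thesis by simp
  qed
  have "integral {a..b} (\<lambda>x. (h x)\<^sup>2) \<le> 0"
  proof (rule field_le_epsilon)
    fix e :: real assume "e > 0"
    have K: "?K \<ge> 0" by (intro integral_nonneg integrable_continuous_real continuous_intros h) auto
    have "integral {a..b} (\<lambda>x. (h x)\<^sup>2) \<le> e / (?K + 1) * ?K"
      using \<open>e > 0\<close> K by (intro le) simp
    also have "\<dots> \<le> e" using \<open>e > 0\<close> K by (simp add: field_simps)
    finally show "integral {a..b} (\<lambda>x. (h x)\<^sup>2) \<le> 0 + e" by simp
  qed
  moreover have "integral {a..b} (\<lambda>x. (h x)\<^sup>2) \<ge> 0"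
    by (intro integral_nonneg integrable_continuous_real continuous_intros h) auto
  ultimately have "integral {a..b} (\<lambda>x. (h x)\<^sup>2) = 0" by simp
  moreover have "continuous_on {a..b} (\<lambda>x. (h x)\<^sup>2)" by (intro continuous_intros h)
  ultimately have "(h x)\<^sup>2 = 0" using integral_eq_0_iff[OF _ ab, of "\<lambda>x. (h x)\<^sup>2"] x by simp
  then show ?thesis by simp
qed

lemma trig_system_complete:
  assumes h: "continuous_on {a..b} h" and per: "h a = h b" and ab: "a < b"
    and mean: "integral {a..b} h = 0"
    and orth: "\<And>k. integral {a..b} (\<lambda>x. \<omega> a b x k * h x) = 0" and x: "x \<in> {a..b}"
  shows "h x = 0"
proof (rule trig_null_eq_0[OF h per ab _ x], unfold trig_null_def, intro allI)
  fix m :: int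
  have hi: "((\<lambda>x. h x * cos (of_int m * phase a b x)) has_integral
      integral {a..b} (\<lambda>x. h x * cos (of_int m * phase a b x))) {a..b}"
    "((\<lambda>x. h x * sin (of_int m * phase a b x)) has_integral
      integral {a..b} (\<lambda>x. h x * sin (of_int m * phase a b x))) {a..b}"
    by (intro integrable_integral integrable_continuous_real continuous_intros h)+
  show "((\<lambda>x. h x * cos (of_int m * phase a b x)) has_integral 0) {a..b} \<and>
        ((\<lambda>x. h x * sin (of_int m * phase a b x)) has_integral 0) {a..b}"
  proof (cases "m = 0")
    case True
    have "(h has_integral 0) {a..b}"
      using integrable_integral[OF integrable_continuous_real[OF h]] mean by simp
    with True show ?thesis by simp
  next
    case False
    define n where "n = nat \<bar>m\<bar> - 1"
    have n: "real (n + 1) = of_int \<bar>m\<bar>" using False by (simp add: n_def)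
    have "sqrt (2 / (b - a)) * integral {a..b} (\<lambda>x. h x * cos (of_int \<bar>m\<bar> * phase a b x)) = 0"
      "sqrt (2 / (b - a)) * integral {a..b} (\<lambda>x. h x * sin (of_int \<bar>m\<bar> * phase a b x)) = 0"
      using orth[of "(n, 2)"] orth[of "(n, 1)"]
      unfolding \<omega>_phase n integral_mult_right[symmetric] by (simp_all add: mult_ac)
    with ab have "integral {a..b} (\<lambda>x. h x * cos (of_int \<bar>m\<bar> * phase a b x)) = 0"
      "integral {a..b} (\<lambda>x. h x * sin (of_int \<bar>m\<bar> * phase a b x)) = 0"
      by simp_all
    then have "integral {a..b} (\<lambda>x. h x * cos (of_int m * phase a b x)) = 0"
      "integral {a..b} (\<lambda>x. h x * sin (of_int m * phase a b x)) = 0"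
      by (cases "m \<ge> 0"; simp)+
    with hi show ?thesis by simp
  qed
qed

section \<open>Absolute convergence of trigonometric series\<close>

text \<open>
  Baire's theorem in the form of a principle of uniform boundedness: countably many closed sets that cover
  an interval cannot all have empty interior.
\<close>

lemma Baire_interval:
  fixes E :: "nat \<Rightarrow> real set"
  assumes "a < b" "\<And>m. closed (E m)" "{a..b} \<subseteq> (\<Union>m. E m)"
  obtains m c d where "c < d" "{c..d} \<subseteq> E m"
proof -
  have "\<exists>m. interior (E m) \<noteq> {}"
  proof (rule ccontr)
    assume "\<nexists>m. interior (E m) \<noteq> {}"
    then have "euclidean interior_of \<Union>(range E) = {}"
      using assms(2) by (intro Baire_category_alt disjI1 completely_metrizable_space_euclidean)
        auto
    then have "interior {a..b} = {}"
      using interior_mono[OF assms(3)] by simp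
    then show False using assms(1) by simp
  qed
  then obtain m y where "y \<in> interior (E m)" by blast
  then obtain e where "e > 0" "cball y e \<subseteq> E m" by (auto simp: mem_interior_cball)
  then show ?thesis
    by (intro that[of "y - e" "y + e" m]) (auto simp: cball_eq_atLeastAtMost)
qed

context
  fixes a b :: real
  assumes ab: "a < b"
begin

lemma freq_pos: "freq a b n > 0"
  using ab by (simp add: freq_def)

text \<open>
  The square of a basis function is \<open>(1 \<plusminus> cos (2 j \<theta>)) / (b - a)\<close>. On any fixed interval the mean of the
  oscillating part tends to \<open>0\<close> as the frequency grows, so high modes keep a fixed share of mass on it.
\<close>

lemma integral_\<omega>_square_ge:
  assumes "c < d"
  shows "((d - c) - 1 / freq a b n) / (b - a) \<le> integral {c..d} (\<lambda>x. (\<omega> a b x (n, r))\<^sup>2)"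
proof -
  define y where "y x = real (n + 1) * phase a b x" for x
  have sq: "(\<omega> a b x (n, r))\<^sup>2 = (if r = 1 then 1 - cos (2 * y x) else 1 + cos (2 * y x)) / (b - a)" for x
  proof -
    have "(\<omega> a b x (n, r))\<^sup>2 = 2 / (b - a) * (if r = 1 then (sin (y x))\<^sup>2 else (cos (y x))\<^sup>2)"
      using ab unfolding \<omega>_phase y_def power_mult_distrib by simp
    moreover have "2 * (sin (y x))\<^sup>2 = 1 - cos (2 * y x)" by (simp add: cos_double_sin)
    moreover have "2 * (cos (y x))\<^sup>2 = 1 + cos (2 * y x)" by (simp add: cos_double_cos)
    ultimately show ?thesis by auto
  qed
  let ?S = "\<lambda>x. 1 / (2 * freq a b n) * sin (2 * y x)"
  have "((\<lambda>x. cos (2 * y x)) has_integral ?S d - ?S c) {c..d}"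
  proof (rule fundamental_theorem_of_calculus)
    fix x
    have "(?S has_real_derivative 1 / (2 * freq a b n) * (cos (2 * y x) * (2 * freq a b n)))
        (at x within {c..d})"
      unfolding y_def[abs_def]
      by (rule derivative_eq_intros refl)+ (simp add: freq_def)
    then show "(?S has_vector_derivative cos (2 * y x)) (at x within {c..d})"
      using freq_pos[of n] by (simp add: has_real_derivative_iff_has_vector_derivative)
  qed (use assms in simp)
  moreover have "((\<lambda>x. 1) has_integral d - c) {c..d}"
    using has_integral_const_real[of "1::real" c d] assms by simp
  ultimately have "((\<lambda>x. (\<omega> a b x (n, r))\<^sup>2) has_integral
      (if r = 1 then (d - c) - (?S d - ?S c) else (d - c) + (?S d - ?S c)) / (b - a)) {c..d}"
    unfolding sq by (auto intro!: has_integral_divide has_integral_diff has_integral_add)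
  moreover have "\<bar>?S d - ?S c\<bar> \<le> 1 / freq a b n"
  proof -
    have "\<bar>sin (2 * y d) - sin (2 * y c)\<bar> \<le> 2"
      using sin_le_one[of "2 * y d"] sin_ge_minus_one[of "2 * y d"]
        sin_le_one[of "2 * y c"] sin_ge_minus_one[of "2 * y c"] by linarith
    moreover have "?S d - ?S c = (sin (2 * y d) - sin (2 * y c)) / (2 * freq a b n)"
      by (simp add: diff_divide_distrib)
    ultimately show ?thesis using freq_pos[of n] by (simp add: abs_mult divide_simps)
  qed
  ultimately show ?thesis
    using ab by (auto simp: integral_unique intro!: divide_right_mono)
qed

text \<open>
  The absolute sums are finite at every point, so by Baire's theorem they are bounded by one number on
  some interval \<open>[c, d]\<close>. Integrating over \<open>[c, d]\<close> bounds \<open>\<Sum> |w k| \<integral> |\<omega> k|\<close>, and these integrals are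
  bounded below for all but finitely many modes, since \<open>|\<omega> k|\<close> dominates a multiple of \<open>(\<omega> k)\<^sup>2\<close>.
\<close>

lemma Denjoy_Luzin:
  assumes summable: "\<And>x. x \<in> {a..b} \<Longrightarrow> (\<lambda>k. \<omega> a b x k * w k) summable_on UNIV"
  shows "(\<lambda>k. \<bar>w k\<bar>) summable_on UNIV"
proof -
  let ?s = "sqrt (2 / (b - a))"
  define E where "E m = {x \<in> {a..b}. \<forall>F. finite F \<longrightarrow> (\<Sum>k\<in>F. \<bar>\<omega> a b x k * w k\<bar>) \<le> real m}" for m
  have closed_E: "closed (E m)" for m
  proof -
    have "E m = (\<Inter>F\<in>Collect finite. {x \<in> {a..b}. (\<Sum>k\<in>F. \<bar>\<omega> a b x k * w k\<bar>) \<le> real m})"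
      by (auto simp: E_def)
    also have "closed \<dots>"
      by (intro closed_INT ballI continuous_on_closed_Collect_le continuous_intros closed_atLeastAtMost)
    finally show ?thesis .
  qed
  have cover: "{a..b} \<subseteq> (\<Union>m. E m)"
  proof
    fix x assume x: "x \<in> {a..b}"
    have s: "(\<lambda>k. \<bar>\<omega> a b x k * w k\<bar>) summable_on UNIV"
      using summable[OF x, THEN summable_on_iff_abs_summable_on_real[THEN iffD1]] by simp
    obtain m where m: "(\<Sum>\<^sub>\<infinity>k. \<bar>\<omega> a b x k * w k\<bar>) \<le> real m"
      using real_arch_simple by blast
    have "(\<Sum>k\<in>F. \<bar>\<omega> a b x k * w k\<bar>) \<le> real m" if "finite F" for F
      using finite_sum_le_infsum[OF s that] m by simp
    then show "x \<in> (\<Union>m. E m)" using x by (auto simp: E_def)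
  qed
  obtain m c d where cd: "c < d" and sub: "{c..d} \<subseteq> E m"
    by (rule Baire_interval[of a b E, OF ab closed_E cover])
  \<comment> \<open>Beyond \<open>N\<close> the oscillating part costs at most half of the length of \<open>[c, d]\<close>.\<close>
  obtain N :: nat where N: "2 / (d - c) \<le> 2 * pi / (b - a) * real N"
  proof -
    have "0 < 2 * pi / (b - a)" using ab by simp
    then obtain N :: nat where "2 / (d - c) < real N * (2 * pi / (b - a))"
      using reals_Archimedean3 by blast
    then show ?thesis by (intro that[of N]) (simp add: mult.commute)
  qed
  have large: "(d - c) / (2 * (b - a)) \<le> integral {c..d} (\<lambda>x. (\<omega> a b x k)\<^sup>2)" if "fst k \<ge> N" for k
  proof -
    obtain n r where k: "k = (n, r)" by (cases k)
    have "2 * pi / (b - a) * real N \<le> freq a b n"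
      unfolding freq_def using that ab by (intro mult_left_mono) (auto simp: k)
    with N have "2 / (d - c) \<le> freq a b n" by linarith
    then have "1 / freq a b n \<le> (d - c) / 2"
      using cd freq_pos[of n] by (simp add: field_simps)
    then have "(d - c) / 2 \<le> (d - c) - 1 / freq a b n" by simp
    then have "(d - c) / 2 / (b - a) \<le> ((d - c) - 1 / freq a b n) / (b - a)"
      using ab by (intro divide_right_mono) auto
    then show ?thesis using integral_\<omega>_square_ge[OF cd, of n r] by (simp add: k)
  qed
  have bound: "(\<Sum>k\<in>F. \<bar>w k\<bar>) \<le> 2 * (b - a) * (?s * real m)"
    if F: "finite F" "F \<subseteq> {k. N \<le> fst k}" for F
  proof -
    have "(\<Sum>k\<in>F. \<bar>w k\<bar>) * ((d - c) / (2 * (b - a))) \<le>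
        (\<Sum>k\<in>F. \<bar>w k\<bar> * integral {c..d} (\<lambda>x. (\<omega> a b x k)\<^sup>2))"
      unfolding sum_distrib_right using F large by (intro sum_mono mult_left_mono) auto
    also have "\<dots> = integral {c..d} (\<lambda>x. \<Sum>k\<in>F. \<bar>w k\<bar> * (\<omega> a b x k)\<^sup>2)"
      using F(1) by (subst integral_sum)
        (auto intro!: integrable_continuous_real continuous_intros)
    also have "\<dots> \<le> integral {c..d} (\<lambda>x. ?s * real m)"
    proof (rule integral_le)
      fix x assume "x \<in> {c..d}"
      with sub F(1) have le: "(\<Sum>k\<in>F. \<bar>\<omega> a b x k * w k\<bar>) \<le> real m" by (auto simp: E_def)
      have "(\<Sum>k\<in>F. \<bar>w k\<bar> * (\<omega> a b x k)\<^sup>2) \<le> (\<Sum>k\<in>F. ?s * \<bar>\<omega> a b x k * w k\<bar>)"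
      proof (rule sum_mono)
        fix k
        have "(\<omega> a b x k)\<^sup>2 = \<bar>\<omega> a b x k\<bar> * \<bar>\<omega> a b x k\<bar>" by (simp add: power2_eq_square)
        also have "\<dots> \<le> ?s * \<bar>\<omega> a b x k\<bar>" using \<omega>_bound[OF ab] by (intro mult_right_mono) auto
        finally have "\<bar>w k\<bar> * (\<omega> a b x k)\<^sup>2 \<le> \<bar>w k\<bar> * (?s * \<bar>\<omega> a b x k\<bar>)"
          by (intro mult_left_mono) auto
        then show "\<bar>w k\<bar> * (\<omega> a b x k)\<^sup>2 \<le> ?s * \<bar>\<omega> a b x k * w k\<bar>"
          by (simp add: abs_mult mult_ac)
      qed
      also have "\<dots> \<le> ?s * real m"
        unfolding sum_distrib_left[symmetric] using le ab by (intro mult_left_mono) auto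
      finally show "(\<Sum>k\<in>F. \<bar>w k\<bar> * (\<omega> a b x k)\<^sup>2) \<le> ?s * real m" .
    qed (intro integrable_continuous_real continuous_intros)+
    also have "\<dots> = ?s * real m * (d - c)" using cd by simp
    finally have "(\<Sum>k\<in>F. \<bar>w k\<bar>) / (2 * (b - a)) * (d - c) \<le> ?s * real m * (d - c)" by simp
    then have "(\<Sum>k\<in>F. \<bar>w k\<bar>) / (2 * (b - a)) \<le> ?s * real m" using cd by (simp del: times_divide_eq_left)
    then show ?thesis using ab by (simp add: pos_divide_le_eq mult.commute)
  qed
  have "(\<lambda>k. \<bar>w k\<bar>) summable_on {k. N \<le> fst k}"
    by (rule nonneg_bdd_above_summable_on) (auto intro!: bdd_aboveI2 bound)
  moreover have "finite {k :: nat \<times> 2. fst k < N}"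
  proof -
    have "{k :: nat \<times> 2. fst k < N} = {..<N} \<times> UNIV" by auto
    then show ?thesis by simp
  qed
  then have "(\<lambda>k. \<bar>w k\<bar>) summable_on {k. fst k < N}" by (rule summable_on_finite)
  ultimately have "(\<lambda>k. \<bar>w k\<bar>) summable_on {k. N \<le> fst k} \<union> {k. fst k < N}"
    by (rule summable_on_Un_disjoint) auto
  moreover have "{k :: nat \<times> 2. N \<le> fst k} \<union> {k. fst k < N} = UNIV" by auto
  ultimately show ?thesis by simp
qed

end

section \<open>Fourier coefficients and expansions\<close>

definition fourier_coeff :: "real \<Rightarrow> real \<Rightarrow> (real \<Rightarrow> real) \<Rightarrow> modes" where
  "fourier_coeff a b g k = integral {a..b} (\<lambda>x. \<omega> a b x k * g x)"

lemma fourier_coeff_cong: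
  "(\<And>x. x \<in> {a..b} \<Longrightarrow> f x = g x) \<Longrightarrow> fourier_coeff a b f k = fourier_coeff a b g k"
  unfolding fourier_coeff_def by (rule integral_cong) simp

lemma fourier_coeff_minus: "fourier_coeff a b (\<lambda>x. - f x) k = - fourier_coeff a b f k"
  by (simp add: fourier_coeff_def)

lemma fourier_coeff_diff:
  assumes "continuous_on {a..b} f" "continuous_on {a..b} g"
  shows "fourier_coeff a b (\<lambda>x. f x - g x) k = fourier_coeff a b f k - fourier_coeff a b g k"
  unfolding fourier_coeff_def right_diff_distrib
  by (intro integral_diff integrable_continuous_real continuous_intros assms)

text \<open>
  The basis does not contain the constant function, which is why the mean is prescribed separately.
\<close>

lemma vanishes_iff_fourier_coeffs_vanish:
  assumes "a < b" "continuous_on {a..b} h" "h a = h b" "integral {a..b} h = 0"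
  shows "(\<forall>x\<in>{a..b}. h x = 0) \<longleftrightarrow> (\<forall>k. fourier_coeff a b h k = 0)"
proof
  assume "\<forall>x\<in>{a..b}. h x = 0"
  then have "fourier_coeff a b h k = fourier_coeff a b (\<lambda>x. 0) k" for k
    by (intro fourier_coeff_cong) simp
  then show "\<forall>k. fourier_coeff a b h k = 0" by (simp add: fourier_coeff_def)
next
  assume "\<forall>k. fourier_coeff a b h k = 0"
  then have "integral {a..b} (\<lambda>x. \<omega> a b x k * h x) = 0" for k
    by (simp only: fourier_coeff_def)
  then show "\<forall>x\<in>{a..b}. h x = 0"
    by (intro ballI trig_system_complete[OF assms(2,3,1,4)])
qed

text \<open>
  Integration by parts. The boundary terms cancel by periodicity, and differentiating the basis exchanges
  sine and cosine within a mode at the cost of a factor \<open>\<plusminus>\<close> frequency.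
\<close>

lemma fourier_coeff_derivative:
  assumes ab: "a < b" and per: "F a = F b" and F'_cont: "continuous_on {a..b} F'"
    and F: "\<And>x. x \<in> {a..b} \<Longrightarrow> (F has_real_derivative F' x) (at x within {a..b})"
  shows "fourier_coeff a b F' = deriv_matrix a b \<cdot>\<^sub>v fourier_coeff a b F"
proof
  fix k :: "nat \<times> 2"
  obtain n r where k: "k = (n, r)" by (cases k)
  have F_cont: "continuous_on {a..b} F"
    using F by (meson DERIV_continuous continuous_on_eq_continuous_within)
  let ?\<omega>' = "\<lambda>x. if r = 1 then freq a b n * \<omega> a b x (n, 2) else - freq a b n * \<omega> a b x (n, 1)"
  have "((\<lambda>x. \<omega> a b x k * F' x + ?\<omega>' x * F x) has_integral \<omega> a b b k * F b - \<omega> a b a k * F a) {a..b}"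
  proof (rule fundamental_theorem_of_calculus)
    fix x assume "x \<in> {a..b}"
    then show "((\<lambda>x. \<omega> a b x k * F x) has_vector_derivative
        (\<omega> a b x k * F' x + ?\<omega>' x * F x)) (at x within {a..b})"
      unfolding has_real_derivative_iff_has_vector_derivative[symmetric] k
      using DERIV_mult[OF \<omega>_derivative[of a b n r x] F[of x]]
      by (simp only: mult.commute add.commute)
  qed (use ab in simp)
  then have "integral {a..b} (\<lambda>x. \<omega> a b x k * F' x + ?\<omega>' x * F x) = 0"
    by (simp add: \<omega>_ends[OF ab] per integral_unique)
  moreover have "integral {a..b} (\<lambda>x. \<omega> a b x k * F' x + ?\<omega>' x * F x) =
      fourier_coeff a b F' k + integral {a..b} (\<lambda>x. ?\<omega>' x * F x)"
    unfolding fourier_coeff_def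
    by (intro integral_add integrable_continuous_real continuous_intros F'_cont F_cont)
       (cases "r = 1"; simp; intro continuous_intros)
  moreover have "integral {a..b} (\<lambda>x. ?\<omega>' x * F x) =
      (if r = 1 then freq a b n * fourier_coeff a b F (n, 2)
       else - freq a b n * fourier_coeff a b F (n, 1))"
    by (simp add: fourier_coeff_def mult.assoc)
  ultimately show "fourier_coeff a b F' k = (deriv_matrix a b \<cdot>\<^sub>v fourier_coeff a b F) k"
    by (auto simp: k deriv_matrix_apply)
qed

lemma integral_derivative_periodic:
  assumes "a < b" "F a = F b"
    and "\<And>x. x \<in> {a..b} \<Longrightarrow> (F has_real_derivative F' x) (at x within {a..b})"
  shows "integral {a..b} F' = 0"
  using fundamental_theorem_of_calculus[of a b F F'] assms
  by (auto simp: has_real_derivative_iff_has_vector_derivative integral_unique)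

text \<open>
  The condition that \<^const>\<open>expanded\<close> imposes at a single time. For continuous \<open>f\<close> it forces \<open>f0\<close> to
  be the mean of \<open>f\<close> (\<open>expansion_mean\<close>).
\<close>

definition is_expansion :: "real \<Rightarrow> real \<Rightarrow> real \<Rightarrow> (real \<Rightarrow> real) \<Rightarrow> modes \<Rightarrow> bool" where
  "is_expansion a b f0 f w \<longleftrightarrow> (\<forall>x\<in>{a..b}. (\<lambda>k. \<omega> a b x k * w k) summable_on UNIV \<and>
     f x = f0 + dot (\<omega> a b x) w)"

context
  fixes a b f0 :: real and f :: "real \<Rightarrow> real" and w :: modes
  assumes ab: "a < b" and f: "continuous_on {a..b} f" and expansion: "is_expansion a b f0 f w"
begin

text \<open>
  The coefficients are absolutely summable by the Denjoy-Luzin theorem and the basis is uniformly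
  bounded, so the series converges uniformly by the Weierstrass test, even after multiplication by \<open>g\<close>.
\<close>

lemma expansion_termwise_integral:
  assumes g: "continuous_on {a..b} g"
  shows "((\<lambda>k. w k * fourier_coeff a b g k) has_sum integral {a..b} (\<lambda>x. (f x - f0) * g x)) UNIV"
proof -
  let ?s = "sqrt (2 / (b - a))"
  let ?T = "\<lambda>k x. \<omega> a b x k * w k * g x"
  have "bounded (g ` {a..b})"
    by (intro compact_imp_bounded compact_continuous_image g compact_Icc)
  then obtain B where B: "\<And>x. x \<in> {a..b} \<Longrightarrow> \<bar>g x\<bar> \<le> B"
    unfolding bounded_real by blast
  have "(\<lambda>k. \<bar>w k\<bar>) summable_on UNIV"
    using expansion by (intro Denjoy_Luzin[OF ab]) (simp add: is_expansion_def)
  then have "(\<lambda>k. ?s * B * \<bar>w k\<bar>) summable_on UNIV" by (rule summable_on_cmult_right)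
  then have "uniform_limit {a..b} (\<lambda>F x. \<Sum>k\<in>F. ?T k x) (\<lambda>x. (f x - f0) * g x)
      (finite_subsets_at_top UNIV)"
  proof (rule Weierstrass_m_test_general'[rotated 2])
    fix k x assume x: "x \<in> {a..b}"
    have "\<bar>\<omega> a b x k\<bar> * \<bar>g x\<bar> \<le> ?s * B"
      using B[OF x] \<omega>_bound[OF ab] ab by (intro mult_mono) auto
    then have "\<bar>w k\<bar> * (\<bar>\<omega> a b x k\<bar> * \<bar>g x\<bar>) \<le> \<bar>w k\<bar> * (?s * B)"
      by (rule mult_left_mono) simp
    then show "norm (?T k x) \<le> ?s * B * \<bar>w k\<bar>" by (simp add: abs_mult mult_ac)
  next
    fix x assume "x \<in> {a..b}"
    then have "((\<lambda>k. \<omega> a b x k * w k) has_sum (f x - f0)) UNIV"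
      using expansion by (auto simp: is_expansion_def dot_def)
    then show "((\<lambda>k. ?T k x) has_sum ((f x - f0) * g x)) UNIV" by (rule has_sum_cmult_left)
  qed
  then obtain I J where I: "\<And>F. ((\<lambda>x. \<Sum>k\<in>F. ?T k x) has_integral I F) {a..b}"
    and J: "((\<lambda>x. (f x - f0) * g x) has_integral J) {a..b}"
    and lim: "(I \<longlongrightarrow> J) (finite_subsets_at_top UNIV)"
    by (rule uniform_limit_integral) (auto intro!: continuous_intros g)
  have "I F = (\<Sum>k\<in>F. w k * fourier_coeff a b g k)" for F
  proof -
    have "I F = integral {a..b} (\<lambda>x. \<Sum>k\<in>F. w k * (\<omega> a b x k * g x))"
      using integral_unique[OF I] by (simp add: mult_ac)
    also have "\<dots> = (\<Sum>k\<in>F. w k * fourier_coeff a b g k)"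
    proof (cases "finite F")
      case True
      then show ?thesis
        by (subst integral_sum)
           (auto simp: fourier_coeff_def intro!: integrable_continuous_real continuous_intros g)
    qed simp
    finally show ?thesis .
  qed
  then have "I = sum (\<lambda>k. w k * fourier_coeff a b g k)" by (simp add: fun_eq_iff)
  with lim integral_unique[OF J] show ?thesis by (simp add: has_sum_def)
qed

lemma expansion_mean: "integral {a..b} f = f0 * (b - a)"
proof -
  have "fourier_coeff a b (\<lambda>x. 1) k = 0" for k
    by (simp add: fourier_coeff_def integral_\<omega>[OF ab])
  then have "((\<lambda>k :: nat \<times> 2. 0 :: real) has_sum integral {a..b} (\<lambda>x. f x - f0)) UNIV"
    using expansion_termwise_integral[of "\<lambda>x. 1"] by simp
  then have "integral {a..b} (\<lambda>x. f x - f0) = 0"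
    using has_sum_unique[OF _ has_sum_0] by blast
  moreover have "integral {a..b} (\<lambda>x. f x - f0) = integral {a..b} f - integral {a..b} (\<lambda>x. f0)"
    by (intro integral_diff integrable_continuous_real continuous_intros f)
  ultimately show ?thesis using ab by simp
qed

text \<open>
  Uniqueness of the expansion: termwise integration against a basis function leaves a single term.
\<close>

lemma expansion_coeffs: "fourier_coeff a b f = w"
proof
  fix k
  have "((\<lambda>j. w j * fourier_coeff a b (\<lambda>x. \<omega> a b x k) j) has_sum w k) UNIV"
    by (rule has_sum_finite_neutralI[of "{k}"]) (auto simp: fourier_coeff_def \<omega>_orthonormal[OF ab])
  then have "w k = integral {a..b} (\<lambda>x. (f x - f0) * \<omega> a b x k)"
    by (rule has_sum_unique) (intro expansion_termwise_integral continuous_intros)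
  also have "\<dots> = integral {a..b} (\<lambda>x. \<omega> a b x k * f x - f0 * \<omega> a b x k)"
    by (simp add: algebra_simps)
  also have "\<dots> = fourier_coeff a b f k - integral {a..b} (\<lambda>x. f0 * \<omega> a b x k)"
    unfolding fourier_coeff_def
    by (intro integral_diff integrable_continuous_real continuous_intros f)
  finally show "fourier_coeff a b f k = w k" by (simp add: integral_\<omega>[OF ab])
qed

text \<open>
  Termwise integration against \<open>f\<close> itself. The mean has to be removed because it is not among the
  coefficients \<open>w\<close>.
\<close>

lemma expansion_Parseval:
  "((\<lambda>k. w k * w k) has_sum (integral {a..b} (\<lambda>x. (f x)\<^sup>2) - f0\<^sup>2 * (b - a))) UNIV"
proof -
  have "integral {a..b} (\<lambda>x. (f x - f0) * f x) = integral {a..b} (\<lambda>x. (f x)\<^sup>2 - f0 * f x)"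
    by (simp add: algebra_simps power2_eq_square)
  also have "\<dots> = integral {a..b} (\<lambda>x. (f x)\<^sup>2) - integral {a..b} (\<lambda>x. f0 * f x)"
    by (intro integral_diff integrable_continuous_real continuous_intros f)
  finally have "integral {a..b} (\<lambda>x. (f x - f0) * f x) = integral {a..b} (\<lambda>x. (f x)\<^sup>2) - f0\<^sup>2 * (b - a)"
    by (simp add: expansion_mean power2_eq_square)
  then show ?thesis
    using expansion_termwise_integral[OF f] by (simp add: expansion_coeffs)
qed

end

section \<open>Partial derivatives of the Hamiltonian\<close>

lemma infsum_change_one:
  fixes f g :: "'i \<Rightarrow> real"
  assumes "f summable_on UNIV" "\<And>i. i \<noteq> k \<Longrightarrow> g i = f i"
  shows "infsum g UNIV = infsum f UNIV + (g k - f k)"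
proof -
  let ?d = "\<lambda>i. if i = k then g k - f k else 0"
  have "(?d has_sum (g k - f k)) UNIV"
    by (rule has_sum_finite_neutralI[of "{k}"]) auto
  then have "((\<lambda>i. f i + ?d i) has_sum (infsum f UNIV + (g k - f k))) UNIV"
    using assms(1) by (intro has_sum_add has_sum_infsum)
  moreover have "(\<lambda>i. f i + ?d i) = g" using assms(2) by auto
  ultimately show ?thesis by (simp add: infsumI)
qed

text \<open>
  Changing the entry \<open>q k\<close> to \<open>h\<close> adds \<open>(h - q k) \<omega> k\<close> to the function \<open>U\<close>. Expanding the square and the
  cube makes the Hamiltonian an explicit cubic polynomial in \<open>h\<close>. Its quadratic form is an infinite sum,
  whose change can be computed entrywise once it is summable at \<open>q\<close>.
\<close>

lemma hamiltonian_partial_q: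
  assumes U: "continuous_on {a..b} U" and expansion: "is_expansion a b u0 U q"
    and energy_sum: "(\<lambda>k. q k * (neg_laplacian_matrix a b \<cdot>\<^sub>v q) k) summable_on UNIV"
  shows "((\<lambda>h. hamiltonian a b u0 (q(k := h)) p) has_real_derivative
     (neg_laplacian_matrix a b \<cdot>\<^sub>v q) k + fourier_coeff a b (\<lambda>x. (U x)\<^sup>2) k) (at (q k))"
proof -
  obtain n r where k: "k = (n, r)" by (cases k)
  let ?L = "\<lambda>q. neg_laplacian_matrix a b \<cdot>\<^sub>v q"
  let ?w = "\<lambda>x. \<omega> a b x k"
  let ?I = "integral {a..b}"
  have quadratic: "dot (q(k := h)) (?L (q(k := h))) =
      dot q (?L q) + (freq a b n)\<^sup>2 * (h\<^sup>2 - (q k)\<^sup>2)" for h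
  proof -
    have "dot (q(k := h)) (?L (q(k := h))) =
        dot q (?L q) + ((q(k := h)) k * ?L (q(k := h)) k - q k * ?L q k)"
      unfolding dot_def
    proof (rule infsum_change_one[OF energy_sum])
      fix i :: "nat \<times> 2" assume "i \<noteq> k"
      then show "(q(k := h)) i * ?L (q(k := h)) i = q i * ?L q i"
        by (cases i) (simp add: neg_laplacian_matrix_apply)
    qed
    then show ?thesis by (simp add: k neg_laplacian_matrix_apply algebra_simps power2_eq_square)
  qed
  have cubic: "?I (\<lambda>x. (u0 + dot (\<omega> a b x) (q(k := h))) ^ 3) =
      ?I (\<lambda>x. (U x) ^ 3) + 3 * (h - q k) * ?I (\<lambda>x. ?w x * (U x)\<^sup>2)
        + (h - q k)\<^sup>2 * ?I (\<lambda>x. 3 * (?w x)\<^sup>2 * U x) + (h - q k) ^ 3 * ?I (\<lambda>x. (?w x) ^ 3)" for h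
  proof -
    have "u0 + dot (\<omega> a b x) (q(k := h)) = U x + (h - q k) * ?w x" if "x \<in> {a..b}" for x
    proof -
      have "dot (\<omega> a b x) (q(k := h)) = dot (\<omega> a b x) q + (?w x * (q(k := h)) k - ?w x * q k)"
        unfolding dot_def
        using expansion that by (intro infsum_change_one) (auto simp: is_expansion_def)
      then show ?thesis using expansion that by (simp add: is_expansion_def algebra_simps)
    qed
    then have "?I (\<lambda>x. (u0 + dot (\<omega> a b x) (q(k := h))) ^ 3) =
        ?I (\<lambda>x. (U x + (h - q k) * ?w x) ^ 3)"
      by (intro integral_cong) simp
    also have "\<dots> = ?I (\<lambda>x. (U x) ^ 3 + 3 * (h - q k) * (?w x * (U x)\<^sup>2)
        + (h - q k)\<^sup>2 * (3 * (?w x)\<^sup>2 * U x) + (h - q k) ^ 3 * (?w x) ^ 3)"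
      by (simp add: power3_eq_cube power2_eq_square algebra_simps)
    also have "\<dots> = ?I (\<lambda>x. (U x) ^ 3) + ?I (\<lambda>x. 3 * (h - q k) * (?w x * (U x)\<^sup>2))
        + ?I (\<lambda>x. (h - q k)\<^sup>2 * (3 * (?w x)\<^sup>2 * U x)) + ?I (\<lambda>x. (h - q k) ^ 3 * (?w x) ^ 3)"
      using U by (simp only: integral_add integrable_continuous_real continuous_intros)
    finally show ?thesis by (simp only: integral_mult_right)
  qed
  have "((\<lambda>h. 1 / 2 * (dot p p + (dot q (?L q) + (freq a b n)\<^sup>2 * (h\<^sup>2 - (q k)\<^sup>2))
     + 2 / 3 * (?I (\<lambda>x. (U x) ^ 3) + 3 * (h - q k) * ?I (\<lambda>x. ?w x * (U x)\<^sup>2)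
        + (h - q k)\<^sup>2 * ?I (\<lambda>x. 3 * (?w x)\<^sup>2 * U x) + (h - q k) ^ 3 * ?I (\<lambda>x. (?w x) ^ 3))))
     has_real_derivative (freq a b n)\<^sup>2 * q k + ?I (\<lambda>x. ?w x * (U x)\<^sup>2)) (at (q k))"
    by (rule derivative_eq_intros refl | simp)+
  then show ?thesis
    unfolding hamiltonian_def quadratic cubic fourier_coeff_def
    by (simp add: k neg_laplacian_matrix_apply)
qed

lemma hamiltonian_partial_p:
  assumes "(\<lambda>k. p k * p k) summable_on UNIV"
  shows "((\<lambda>h. hamiltonian a b u0 q (p(k := h))) has_real_derivative p k) (at (p k))"
proof -
  have "dot (p(k := h)) (p(k := h)) = dot p p + (h * h - p k * p k)" for h
    unfolding dot_def using infsum_change_one[OF assms, of k "\<lambda>i. (p(k := h)) i * (p(k := h)) i"]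
    by simp
  then show ?thesis
    unfolding hamiltonian_def by (auto intro!: derivative_eq_intros)
qed

section \<open>Regular periodic functions\<close>

lemma deriv_periodic:
  fixes g :: "real \<Rightarrow> real"
  assumes "\<And>x. g (x + L) = g x"
  shows "deriv g (x + L) = deriv g x"
  using DERIV_shift[of g _ x L] assms by (simp add: deriv_def)

lemma funpow_deriv_periodic:
  fixes g :: "real \<Rightarrow> real"
  assumes "\<And>x. g (x + L) = g x"
  shows "(deriv ^^ k) g (x + L) = (deriv ^^ k) g x"
proof (induction k arbitrary: x)
  case (Suc k)
  then show ?case using deriv_periodic[of "(deriv ^^ k) g" L] by simp
qed (simp add: assms)

context
  fixes a b :: real and f :: "real \<Rightarrow> real \<Rightarrow> real"
  assumes reg: "periodic_regular a b f"
begin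

lemma regular_dx_ends: "t \<ge> 0 \<Longrightarrow> dx k f b t = dx k f a t"
  using funpow_deriv_periodic[of "\<lambda>y. f y t" "b - a" k a] reg
  by (simp add: periodic_regular_def dx_def)

lemma regular_dx_derivative:
  assumes "t \<ge> 0" "k < 3"
  shows "((\<lambda>y. dx k f y t) has_real_derivative dx (Suc k) f x t) (at x within S)"
proof -
  have "(\<lambda>y. dx k f y t) differentiable (at x)"
    using reg assms unfolding periodic_regular_def by blast
  then have "DERIV (\<lambda>y. dx k f y t) x :> deriv (\<lambda>y. dx k f y t) x"
    using DERIV_deriv_iff_real_differentiable by blast
  moreover have "deriv (\<lambda>y. dx k f y t) x = dx (Suc k) f x t"
    by (simp add: dx_def)
  ultimately show ?thesis by (simp add: has_field_derivative_at_within)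
qed

lemma regular_dx_cont:
  assumes "t \<ge> 0" "k \<le> 3"
  shows "continuous_on {a..b} (\<lambda>x. dx k f x t)"
proof -
  have "continuous_on ({a..b} \<times> {0..}) (\<lambda>(x, t). dx k f x t)"
    using reg assms unfolding periodic_regular_def by blast
  then have "continuous_on {a..b} (\<lambda>x. case (x, t) of (x, t) \<Rightarrow> dx k f x t)"
    by (rule continuous_on_compose2) (use assms in \<open>auto intro!: continuous_intros\<close>)
  then show ?thesis by simp
qed

lemma regular_dt_cont2: "continuous_on ({a..b} \<times> {0..}) (\<lambda>(x, t). dt f x t)"
  using reg unfolding periodic_regular_def by blast

lemma regular_dt_cont:
  assumes "t \<ge> 0"
  shows "continuous_on {a..b} (\<lambda>x. dt f x t)"
proof -
  have "continuous_on {a..b} (\<lambda>x. case (x, t) of (x, t) \<Rightarrow> dt f x t)"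
    by (rule continuous_on_compose2[OF regular_dt_cont2])
       (use assms in \<open>auto intro!: continuous_intros\<close>)
  then show ?thesis by simp
qed

lemma regular_dt_derivative:
  assumes "x \<in> {a..b}" "t \<ge> 0"
  shows "(f x has_vector_derivative dt f x t) (at t within {0..})"
proof -
  have "f x differentiable (at t within {0..})"
    using reg assms unfolding periodic_regular_def by blast
  then show ?thesis by (simp add: dt_def vector_derivative_works)
qed

lemma regular_dt_ends:
  assumes "t \<ge> 0"
  shows "dt f b t = dt f a t"
proof -
  have "f b s = f a s" if "s \<ge> 0" for s using regular_dx_ends[OF that, of 0] by (simp add: dx_def)
  then show ?thesis
    unfolding dt_def using assms by (intro vector_derivative_cong_eq) auto
qed

text \<open>
  Differentiation under the integral sign, on the closed half-line of times.
\<close>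

lemma integral_time_derivative:
  assumes \<phi>: "continuous_on {a..b} \<phi>" and t: "t \<ge> 0"
  shows "((\<lambda>s. integral {a..b} (\<lambda>x. \<phi> x * f x s)) has_real_derivative
     integral {a..b} (\<lambda>x. \<phi> x * dt f x t)) (at t within {0..})"
proof -
  have "((\<lambda>s. integral (cbox a b) (\<lambda>x. \<phi> x * f x s)) has_vector_derivative
     integral (cbox a b) (\<lambda>x. \<phi> x * dt f x t)) (at t within {0..})"
  proof (rule leibniz_rule_vector_derivative)
    fix s x :: real assume "s \<in> {0..}" "x \<in> cbox a b"
    then show "((\<lambda>s. \<phi> x * f x s) has_vector_derivative \<phi> x * dt f x s) (at s within {0..})"
      using regular_dt_derivative[of x s] by (auto intro!: derivative_eq_intros)
  next
    fix s :: real assume "s \<in> {0..}"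
    then show "(\<lambda>x. \<phi> x * f x s) integrable_on cbox a b"
      using regular_dx_cont[of s 0] by (auto simp: dx_def intro!: integrable_continuous_real continuous_intros \<phi>)
  next
    have "continuous_on ({0..} \<times> cbox a b) (\<lambda>z. \<phi> (snd z))"
      by (intro continuous_on_compose2[OF \<phi>] continuous_intros) auto
    moreover have "continuous_on ({0..} \<times> cbox a b)
        (\<lambda>z. case (snd z, fst z) of (x, t) \<Rightarrow> dt f x t)"
      by (rule continuous_on_compose2[OF regular_dt_cont2]) (auto intro!: continuous_intros)
    then have "continuous_on ({0..} \<times> cbox a b) (\<lambda>z. dt f (snd z) (fst z))" by simp
    ultimately show "continuous_on ({0..} \<times> cbox a b) (\<lambda>(s, x). \<phi> x * dt f x s)"
      unfolding split_beta by (rule continuous_on_mult)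
  qed (use t in auto)
  then show ?thesis by (simp add: has_real_derivative_iff_has_vector_derivative)
qed

end

section \<open>Time-dependent expansions\<close>

lemma has_real_derivative_half_line_unique:
  assumes "(g has_real_derivative D) (at t within {0..})" "(g has_real_derivative D') (at t within {0..})"
    "t \<ge> (0::real)"
  shows "D = D'"
proof -
  have "at t within {0..} \<noteq> bot"
    using assms(3) islimpt_subset[of t "{t..t + 1}" "{0..}"]
    by (auto simp: trivial_limit_within islimpt_Icc)
  then show ?thesis
    using assms(1,2) unfolding has_real_derivative_iff_has_vector_derivative
    by (rule vector_derivative_unique_within)
qed

context
  fixes a b f0 :: real and f :: "real \<Rightarrow> real \<Rightarrow> real" and w :: "real \<Rightarrow> modes"
  assumes ab: "a < b" and reg: "periodic_regular a b f" and expand: "expanded a b f0 f w"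
begin

lemma expanded_slice: "t \<ge> 0 \<Longrightarrow> is_expansion a b f0 (\<lambda>x. f x t) (w t)"
  using expand by (simp add: expanded_def is_expansion_def)

lemma expanded_cont: "t \<ge> 0 \<Longrightarrow> continuous_on {a..b} (\<lambda>x. f x t)"
  using regular_dx_cont[OF reg, of t 0] by (simp add: dx_def)

lemma expanded_coeffs: "t \<ge> 0 \<Longrightarrow> fourier_coeff a b (\<lambda>x. f x t) = w t"
  using expansion_coeffs[OF ab expanded_cont expanded_slice] .

lemma fourier_coeff_dx:
  assumes "t \<ge> 0" "k < 3"
  shows "fourier_coeff a b (\<lambda>x. dx (Suc k) f x t) =
     deriv_matrix a b \<cdot>\<^sub>v fourier_coeff a b (\<lambda>x. dx k f x t)"
  using assms regular_dx_ends[OF reg assms(1), of k]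
  by (intro fourier_coeff_derivative[OF ab] regular_dx_cont[OF reg] regular_dx_derivative[OF reg]) auto

lemma fourier_coeff_dx1: "t \<ge> 0 \<Longrightarrow> fourier_coeff a b (\<lambda>x. dx 1 f x t) = deriv_matrix a b \<cdot>\<^sub>v w t"
  using fourier_coeff_dx[of t 0] expanded_coeffs[of t] by (simp add: dx_def)

lemma fourier_coeff_dx2:
  "t \<ge> 0 \<Longrightarrow> fourier_coeff a b (\<lambda>x. - dx 2 f x t) = neg_laplacian_matrix a b \<cdot>\<^sub>v w t"
proof
  fix k
  assume t: "t \<ge> 0"
  have "fourier_coeff a b (\<lambda>x. dx 2 f x t) = deriv_matrix a b \<cdot>\<^sub>v deriv_matrix a b \<cdot>\<^sub>v w t"
    using fourier_coeff_dx[OF t, of 1] unfolding fourier_coeff_dx1[OF t] by (simp add: numeral_2_eq_2)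
  then show "fourier_coeff a b (\<lambda>x. - dx 2 f x t) k = (neg_laplacian_matrix a b \<cdot>\<^sub>v w t) k"
    by (simp add: fourier_coeff_minus deriv_matrix_twice)
qed

lemma fourier_coeff_dx3:
  assumes "t \<ge> 0"
  shows "fourier_coeff a b (\<lambda>x. - dx 3 f x t) = deriv_matrix a b \<cdot>\<^sub>v neg_laplacian_matrix a b \<cdot>\<^sub>v w t"
proof -
  have "fourier_coeff a b (\<lambda>x. - dx 3 f x t) = deriv_matrix a b \<cdot>\<^sub>v fourier_coeff a b (\<lambda>x. - dx 2 f x t)"
    using assms regular_dx_ends[OF reg assms, of 2] regular_dx_derivative[OF reg assms, of 2]
    by (intro fourier_coeff_derivative[OF ab] continuous_intros regular_dx_cont[OF reg] DERIV_minus)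
       auto
  then show ?thesis using fourier_coeff_dx2[OF assms] by simp
qed

text \<open>
  The expansion uses the same constant \<open>f0\<close> at all times, hence the mean of \<open>f\<close> does not depend on time.
\<close>

lemma integral_dt: "t \<ge> 0 \<Longrightarrow> integral {a..b} (\<lambda>x. dt f x t) = 0"
proof -
  assume t: "t \<ge> 0"
  have "((\<lambda>s. integral {a..b} (\<lambda>x. f x s)) has_real_derivative
      integral {a..b} (\<lambda>x. dt f x t)) (at t within {0..})"
    using integral_time_derivative[OF reg continuous_on_const t, of 1] by simp
  moreover have "((\<lambda>s. integral {a..b} (\<lambda>x. f x s)) has_real_derivative 0) (at t within {0..})"
    using t expansion_mean[OF ab expanded_cont expanded_slice]
    by (intro has_field_derivative_transform_within[OF DERIV_const[of "f0 * (b - a)"] zero_less_one])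
       auto
  ultimately show ?thesis by (rule has_real_derivative_half_line_unique[OF _ _ t])
qed

text \<open>
  The coefficient is an inner product of \<open>f(\<cdot>, s)\<close> with a basis function, so its derivative is the
  corresponding coefficient of the time derivative of \<open>f\<close>. Being unique, it is the only candidate for \<open>D\<close>.
\<close>

lemma coefficient_ode_iff:
  assumes t: "t \<ge> 0"
  shows "((\<lambda>s. w s k) has_real_derivative D) (at t within {0..}) \<longleftrightarrow>
     fourier_coeff a b (\<lambda>x. dt f x t) k = D"
proof -
  have "((\<lambda>s. fourier_coeff a b (\<lambda>x. f x s) k) has_real_derivative
      fourier_coeff a b (\<lambda>x. dt f x t) k) (at t within {0..})"
    unfolding fourier_coeff_def by (intro integral_time_derivative[OF reg] continuous_intros t)
  then have "((\<lambda>s. w s k) has_real_derivative fourier_coeff a b (\<lambda>x. dt f x t) k) (at t within {0..})"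
    by (rule has_field_derivative_transform_within[OF _ zero_less_one])
       (use t in \<open>auto simp: expanded_coeffs\<close>)
  then show ?thesis using has_real_derivative_half_line_unique[OF _ _ t] by blast
qed

text \<open>
  Termwise integration against \<open>-f\<^sub>x\<^sub>x\<close>, whose coefficients are \<open>(D\<^sup>2 \<otimes> I\<^sub>2) w\<close>, followed by one
  integration by parts.
\<close>

lemma stiffness_energy:
  assumes t: "t \<ge> 0"
  shows "((\<lambda>k. w t k * (neg_laplacian_matrix a b \<cdot>\<^sub>v w t) k) has_sum
     integral {a..b} (\<lambda>x. (dx 1 f x t)\<^sup>2)) UNIV"
proof -
  let ?g = "\<lambda>x. (f x t - f0) * dx 1 f x t"
  have f': "((\<lambda>x. f x t) has_real_derivative dx 1 f x t) (at x within {a..b})" for x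
    using regular_dx_derivative[OF reg t, of 0] by (simp add: dx_def)
  have f'': "((\<lambda>x. dx 1 f x t) has_real_derivative dx 2 f x t) (at x within {a..b})" for x
    using regular_dx_derivative[OF reg t, of 1] by (simp add: numeral_2_eq_2)
  have cont: "continuous_on {a..b} (\<lambda>x. dx k f x t)" if "k \<le> 3" for k
    using regular_dx_cont[OF reg t that] .
  have "(?g has_real_derivative (dx 1 f x t)\<^sup>2 - (f x t - f0) * - dx 2 f x t) (at x within {a..b})" for x
    by (rule derivative_eq_intros f' f'' refl)+ (simp add: power2_eq_square)
  moreover have "?g a = ?g b"
    using regular_dx_ends[OF reg t, of 0] regular_dx_ends[OF reg t, of 1] by (simp add: dx_def)
  ultimately have "integral {a..b} (\<lambda>x. (dx 1 f x t)\<^sup>2 - (f x t - f0) * - dx 2 f x t) = 0"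
    by (intro integral_derivative_periodic[OF ab, of ?g])
  moreover have "integral {a..b} (\<lambda>x. (dx 1 f x t)\<^sup>2 - (f x t - f0) * - dx 2 f x t) =
      integral {a..b} (\<lambda>x. (dx 1 f x t)\<^sup>2) - integral {a..b} (\<lambda>x. (f x t - f0) * - dx 2 f x t)"
    by (intro integral_diff integrable_continuous_real continuous_intros cont expanded_cont t) simp_all
  ultimately have "integral {a..b} (\<lambda>x. (f x t - f0) * - dx 2 f x t) = integral {a..b} (\<lambda>x. (dx 1 f x t)\<^sup>2)"
    by simp
  then show ?thesis
    using expansion_termwise_integral[OF ab expanded_cont[OF t] expanded_slice[OF t], of "\<lambda>x. - dx 2 f x t"]
    by (simp add: fourier_coeff_dx2[OF t] cont continuous_on_minus)
qed

end

section \<open>The Hamiltonian form\<close>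

context
  fixes a b u0 v0 :: real and u v :: "real \<Rightarrow> real \<Rightarrow> real" and q p :: "real \<Rightarrow> modes" and t :: real
  assumes ab: "a < b" and u: "periodic_regular a b u" "expanded a b u0 u q"
    and v: "periodic_regular a b v" "expanded a b v0 v p" and t: "t \<ge> 0"
begin

lemma ode_rhs_fourier:
  "ode_rhs a b u0 (q t) (p t) =
     stack (deriv_matrix a b \<cdot>\<^sub>v p t)
       (deriv_matrix a b \<cdot>\<^sub>v (\<lambda>k. (neg_laplacian_matrix a b \<cdot>\<^sub>v q t) k
          + fourier_coeff a b (\<lambda>x. (u x t)\<^sup>2) k))"
proof -
  have "integral {a..b} (\<lambda>x. \<omega> a b x k * (u0 + dot (\<omega> a b x) (q t))\<^sup>2) =
      fourier_coeff a b (\<lambda>x. (u x t)\<^sup>2) k" for k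
    unfolding fourier_coeff_def using u(2) t by (intro integral_cong) (simp add: expanded_def)
  then show ?thesis by (simp add: ode_rhs_def)
qed

text \<open>
  Both sides say that the residuals of the two equations vanish: on the left pointwise, on the right in
  their Fourier coefficients. These agree because the residuals are continuous, periodic and of mean zero.
\<close>

lemma pde_iff_ode_at:
  "(\<forall>x\<in>{a..b}. dt u x t = dx 1 v x t \<and>
       dt v x t = - dx 3 u x t + dx 1 (\<lambda>y s. (u y s)\<^sup>2) x t) \<longleftrightarrow>
   (\<forall>i. ((\<lambda>s. stack (q s) (p s) i) has_real_derivative ode_rhs a b u0 (q t) (p t) i)
        (at t within {0..}))"
proof -
  let ?K = "deriv_matrix a b" and ?c = "fourier_coeff a b"
  let ?s = "\<lambda>x. dx 1 (\<lambda>y s. (u y s)\<^sup>2) x t"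
  let ?R = "\<lambda>x. dt u x t - dx 1 v x t"
  let ?S = "\<lambda>x. dt v x t - (- dx 3 u x t + ?s x)"
  let ?rhs = "\<lambda>k. (neg_laplacian_matrix a b \<cdot>\<^sub>v q t) k + ?c (\<lambda>x. (u x t)\<^sup>2) k"
  have u': "((\<lambda>x. u x t) has_real_derivative dx 1 u x t) (at x within S)" for x S
    using regular_dx_derivative[OF u(1) t, of 0] by (simp add: dx_def)
  have u'': "((\<lambda>x. dx 2 u x t) has_real_derivative dx 3 u x t) (at x within S)" for x S
    using regular_dx_derivative[OF u(1) t, of 2] by (simp add: numeral_3_eq_3)
  have v': "((\<lambda>x. v x t) has_real_derivative dx 1 v x t) (at x within S)" for x S
    using regular_dx_derivative[OF v(1) t, of 0] by (simp add: dx_def)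
  have sq: "((\<lambda>x. (u x t)\<^sup>2) has_real_derivative 2 * u x t * dx 1 u x t) (at x within S)" for x S
    by (rule derivative_eq_intros u' refl)+ simp
  then have s: "?s x = 2 * u x t * dx 1 u x t" for x
    using DERIV_imp_deriv[OF sq] by (simp add: dx_def)
  have ends: "u a t = u b t" "v a t = v b t"
    "dt u b t = dt u a t" "dt v b t = dt v a t" "dx k u b t = dx k u a t" "dx k v b t = dx k v a t" for k
    using regular_dx_ends[OF u(1) t, of 0] regular_dx_ends[OF v(1) t, of 0]
      regular_dx_ends[OF u(1) t] regular_dx_ends[OF v(1) t]
      regular_dt_ends[OF u(1) t] regular_dt_ends[OF v(1) t] by (simp_all add: dx_def)
  note cont = expanded_cont[OF ab u t] regular_dt_cont[OF u(1) t] regular_dt_cont[OF v(1) t]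
    regular_dx_cont[OF u(1) t] regular_dx_cont[OF v(1) t]
  have cont_s: "continuous_on {a..b} ?s"
    unfolding s by (intro continuous_intros cont) simp
  have c_s: "?c ?s = ?K \<cdot>\<^sub>v ?c (\<lambda>x. (u x t)\<^sup>2)"
  proof (rule fourier_coeff_derivative[OF ab _ cont_s])
    show "((\<lambda>x. (u x t)\<^sup>2) has_real_derivative ?s x) (at x within {a..b})" for x
      unfolding s by (rule sq)
  qed (simp add: ends)
  have cR: "?c ?R k = ?c (\<lambda>x. dt u x t) k - (?K \<cdot>\<^sub>v p t) k" for k
    by (subst fourier_coeff_diff) (simp_all add: cont fourier_coeff_dx1[OF ab v t, simplified])
  have cS: "?c ?S k = ?c (\<lambda>x. dt v x t) k - (?K \<cdot>\<^sub>v ?rhs) k" for k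
  proof -
    have "?c (\<lambda>x. - dx 3 u x t + ?s x) k = (?K \<cdot>\<^sub>v ?rhs) k"
    proof -
      have "?c (\<lambda>x. - dx 3 u x t + ?s x) k = ?c (\<lambda>x. - dx 3 u x t) k + ?c ?s k"
        unfolding fourier_coeff_def distrib_left
        by (intro integral_add integrable_continuous_real continuous_intros cont cont_s) simp_all
      also have "\<dots> = (?K \<cdot>\<^sub>v ?rhs) k"
        unfolding fourier_coeff_dx3[OF ab u t] c_s
        by (cases k) (simp add: deriv_matrix_apply algebra_simps)
      finally show ?thesis .
    qed
    moreover have "?c ?S k = ?c (\<lambda>x. dt v x t) k - ?c (\<lambda>x. - dx 3 u x t + ?s x) k"
      by (intro fourier_coeff_diff continuous_intros cont cont_s) simp_all
    ultimately show ?thesis by simp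
  qed
  have "integral {a..b} ?R = 0"
  proof -
    have "integral {a..b} ?R = integral {a..b} (\<lambda>x. dt u x t) - integral {a..b} (\<lambda>x. dx 1 v x t)"
      by (intro integral_diff integrable_continuous_real cont) simp
    then show ?thesis
      using integral_dt[OF ab u t] integral_derivative_periodic[OF ab ends(2) v'] by simp
  qed
  then have R: "(\<forall>x\<in>{a..b}. ?R x = 0) \<longleftrightarrow> (\<forall>k. ?c ?R k = 0)"
    by (intro vanishes_iff_fourier_coeffs_vanish[OF ab] continuous_intros cont) (simp_all add: ends)
  have S_mean: "integral {a..b} ?S = 0"
  proof -
    let ?F = "\<lambda>x. - dx 2 u x t + (u x t)\<^sup>2"
    have "(?F has_real_derivative - dx 3 u x t + ?s x) (at x within {a..b})" for x
      unfolding s by (intro DERIV_add DERIV_minus sq u'')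
    moreover have "?F a = ?F b" by (simp add: ends)
    ultimately have "integral {a..b} (\<lambda>x. - dx 3 u x t + ?s x) = 0"
      by (intro integral_derivative_periodic[OF ab, of ?F])
    moreover have "integral {a..b} ?S =
        integral {a..b} (\<lambda>x. dt v x t) - integral {a..b} (\<lambda>x. - dx 3 u x t + ?s x)"
      by (intro integral_diff integrable_continuous_real continuous_intros cont cont_s) simp
    ultimately show ?thesis using integral_dt[OF ab v t] by simp
  qed
  have S_ends: "?S a = ?S b" by (simp only: s ends)
  have S: "(\<forall>x\<in>{a..b}. ?S x = 0) \<longleftrightarrow> (\<forall>k. ?c ?S k = 0)"
    by (intro vanishes_iff_fourier_coeffs_vanish[OF ab _ S_ends S_mean] continuous_intros cont cont_s)
       simp_all
  have "(\<forall>x\<in>{a..b}. dt u x t = dx 1 v x t \<and> dt v x t = - dx 3 u x t + ?s x) \<longleftrightarrow>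
      (\<forall>x\<in>{a..b}. ?R x = 0) \<and> (\<forall>x\<in>{a..b}. ?S x = 0)" by auto
  also have "\<dots> \<longleftrightarrow> (\<forall>k. ?c (\<lambda>x. dt u x t) k = (?K \<cdot>\<^sub>v p t) k) \<and>
      (\<forall>k. ?c (\<lambda>x. dt v x t) k = (?K \<cdot>\<^sub>v ?rhs) k)"
    unfolding R S cR cS by simp
  also have "\<dots> \<longleftrightarrow> (\<forall>k. ((\<lambda>s. q s k) has_real_derivative (?K \<cdot>\<^sub>v p t) k) (at t within {0..})) \<and>
      (\<forall>k. ((\<lambda>s. p s k) has_real_derivative (?K \<cdot>\<^sub>v ?rhs) k) (at t within {0..}))"
    unfolding coefficient_ode_iff[OF ab u t] coefficient_ode_iff[OF ab v t] ..
  also have "\<dots> \<longleftrightarrow> (\<forall>i. ((\<lambda>s. stack (q s) (p s) i) has_real_derivative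
      ode_rhs a b u0 (q t) (p t) i) (at t within {0..}))"
    unfolding ode_rhs_fourier by (simp add: split_paired_all stack_def forall_2)
  finally show ?thesis .
qed

lemma hamiltonian_gradient:
  "has_partials (hamiltonian a b u0) (q t) (p t)"
  "grad (hamiltonian a b u0) (q t) (p t) =
     stack (\<lambda>k. (neg_laplacian_matrix a b \<cdot>\<^sub>v q t) k + fourier_coeff a b (\<lambda>x. (u x t)\<^sup>2) k) (p t)"
proof -
  have pp: "(\<lambda>k. p t k * p t k) summable_on UNIV"
    using expansion_Parseval[OF ab expanded_cont[OF ab v t] expanded_slice[OF ab v t]]
    by (rule has_sum_imp_summable)
  have qq: "(\<lambda>k. q t k * (neg_laplacian_matrix a b \<cdot>\<^sub>v q t) k) summable_on UNIV"
    using stiffness_energy[OF ab u t] by (rule has_sum_imp_summable)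
  note D = hamiltonian_partial_q[OF expanded_cont[OF ab u t] expanded_slice[OF ab u t] qq]
    hamiltonian_partial_p[OF pp]
  show "has_partials (hamiltonian a b u0) (q t) (p t)"
    unfolding has_partials_def using D real_differentiable_def by blast
  show "grad (hamiltonian a b u0) (q t) (p t) =
     stack (\<lambda>k. (neg_laplacian_matrix a b \<cdot>\<^sub>v q t) k + fourier_coeff a b (\<lambda>x. (u x t)\<^sup>2) k) (p t)"
    unfolding grad_def by (simp only: DERIV_imp_deriv[OF D(1)] DERIV_imp_deriv[OF D(2)])
qed

text \<open>
  The only discrepancy is the share of the mean of \<open>v\<close> in \<open>\<integral> v\<^sup>2\<close>. The corresponding share for \<open>u\<close>
  does not arise, since \<open>u\<close> enters the quadratic part only through its derivative.
\<close>

lemma hamiltonian_eq_energy: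
  "hamiltonian a b u0 (q t) (p t) = energy a b (\<lambda>x. u x t) (\<lambda>x. v x t) + - (v0\<^sup>2 * (b - a) / 2)"
proof -
  let ?I = "integral {a..b}"
  have kinetic: "dot (p t) (p t) = ?I (\<lambda>x. (v x t)\<^sup>2) - v0\<^sup>2 * (b - a)"
    unfolding dot_def
    using expansion_Parseval[OF ab expanded_cont[OF ab v t] expanded_slice[OF ab v t]]
    by (rule infsumI)
  have stiffness: "dot (q t) (neg_laplacian_matrix a b \<cdot>\<^sub>v q t) = ?I (\<lambda>x. (dx 1 u x t)\<^sup>2)"
    unfolding dot_def using stiffness_energy[OF ab u t] by (rule infsumI)
  have cubic: "?I (\<lambda>x. (u0 + dot (\<omega> a b x) (q t)) ^ 3) = ?I (\<lambda>x. (u x t) ^ 3)"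
    using u(2) t by (intro integral_cong) (simp add: expanded_def)
  have "?I (\<lambda>x. (v x t)\<^sup>2 + 2 / 3 * (u x t) ^ 3 + (dx 1 u x t)\<^sup>2) =
      ?I (\<lambda>x. (v x t)\<^sup>2) + ?I (\<lambda>x. 2 / 3 * (u x t) ^ 3) + ?I (\<lambda>x. (dx 1 u x t)\<^sup>2)"
    using expanded_cont[OF ab u t] expanded_cont[OF ab v t] regular_dx_cont[OF u(1) t, of 1]
    by (simp add: integral_add integrable_continuous_real continuous_intros)
  then have "energy a b (\<lambda>x. u x t) (\<lambda>x. v x t) =
      1 / 2 * (?I (\<lambda>x. (v x t)\<^sup>2) + 2 / 3 * ?I (\<lambda>x. (u x t) ^ 3) + ?I (\<lambda>x. (dx 1 u x t)\<^sup>2))"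
    by (simp add: energy_def dx_def)
  then show ?thesis
    unfolding hamiltonian_def kinetic stiffness cubic by (simp add: field_simps)
qed

end

theorem theorem4:
  fixes a b u0 v0 :: real
  assumes "a < b"
  shows "(\<forall>u v q p.
            periodic_regular a b u \<and> periodic_regular a b v \<and>
            expanded a b u0 u q \<and> expanded a b v0 v p \<longrightarrow>
              (pde_system a b u v \<longleftrightarrow> ode_system a b u0 q p) \<and>
              (\<forall>t\<ge>0. has_partials (hamiltonian a b u0) (q t) (p t) \<and>
                 ode_rhs a b u0 (q t) (p t) =
                   (entries abs_J2 \<otimes>\<^sub>K Dmat a b \<otimes>\<^sub>K entries (transpose J2)) \<cdot>\<^sub>v
                     grad (hamiltonian a b u0) (q t) (p t)))
       \<and> (\<exists>C. \<forall>u v q p.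
            periodic_regular a b u \<and> periodic_regular a b v \<and>
            expanded a b u0 u q \<and> expanded a b v0 v p \<longrightarrow>
              (\<forall>t\<ge>0. hamiltonian a b u0 (q t) (p t) =
                 energy a b (\<lambda>x. u x t) (\<lambda>x. v x t) + C))"
proof (intro conjI allI impI)
  fix u v :: "real \<Rightarrow> real \<Rightarrow> real" and q p :: "real \<Rightarrow> modes"
  assume "periodic_regular a b u \<and> periodic_regular a b v \<and>
    expanded a b u0 u q \<and> expanded a b v0 v p"
  then have u: "periodic_regular a b u" "expanded a b u0 u q"
    and v: "periodic_regular a b v" "expanded a b v0 v p" by simp_all
  have "(\<forall>t\<ge>0. \<forall>x\<in>{a..b}. dt u x t = dx 1 v x t \<and>
       dt v x t = - dx 3 u x t + dx 1 (\<lambda>y s. (u y s)\<^sup>2) x t) \<longleftrightarrow> ode_system a b u0 q p"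
    unfolding ode_system_def using pde_iff_ode_at[OF assms u v] by simp
  then show "pde_system a b u v \<longleftrightarrow> ode_system a b u0 q p"
    unfolding pde_system_def by blast
  fix t :: real assume t: "t \<ge> 0"
  show "has_partials (hamiltonian a b u0) (q t) (p t)"
    by (rule hamiltonian_gradient(1)[OF assms u v t])
  show "ode_rhs a b u0 (q t) (p t) =
      (entries abs_J2 \<otimes>\<^sub>K Dmat a b \<otimes>\<^sub>K entries (transpose J2)) \<cdot>\<^sub>v
        grad (hamiltonian a b u0) (q t) (p t)"
    unfolding hamiltonian_gradient(2)[OF assms u v t] structure_matrix_apply
    by (rule ode_rhs_fourier[OF assms u v t])
next
  show "\<exists>C. \<forall>u v q p. periodic_regular a b u \<and> periodic_regular a b v \<and>
      expanded a b u0 u q \<and> expanded a b v0 v p \<longrightarrow>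
        (\<forall>t\<ge>0. hamiltonian a b u0 (q t) (p t) = energy a b (\<lambda>x. u x t) (\<lambda>x. v x t) + C)"
    using hamiltonian_eq_energy[OF assms] by blast
qed

end
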